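(* Let $1\le k<n$, $d=k(n-k)$, and let $S=(\beta_1,\dots,\beta_d)$ be a birational sequence for $\mathrm{Gr}(k,\mathbb C^n)$. Let $i_1,\dots,i_k\in\{1,\dots,n\}$ be pairwise distinct. Then $$S'=(\varepsilon_{i_1}-\varepsilon_{n+1},\dots,\varepsilon_{i_k}-\varepsilon_{n+1},\beta_1,\dots,\beta_d)$$ is a birational sequence for $\mathrm{Gr}(k,\mathbb C^{n+1})$.
   Context: The positive roots of type $\mathtt A_{n-1}$ are $\varepsilon_i-\varepsilon_j$ with $1\le i<j\le n$, where $\varepsilon_1,\dots,\varepsilon_n$ is the standard basis of $\mathbb R^n$; positive roots of type $\mathtt A_{n-1}$ are regarded as positive roots of type $\mathtt A_n$ in the obvious way. For a positive root $\beta=\varepsilon_i-\varepsilon_j$ let $f_\beta=f_{i,j}$ be the elementary $n\times n$ matrix whose only nonzero entry is a $1$ in position $(j,i)$ (row $j$, column $i$), and let $U_{-\beta}=\{\exp(zf_\beta)=\mathbb 1+zf_\beta\mid z\in\mathbb C\}$. Let $U^-\subset SL_n(\mathbb C)$ be the group of lower triangular matrices with $1$'s on the diagonal. $\mathrm{Gr}(k,\mathbb C^n)\cong SL_n/P_k$, where $P_k$ is the group of block upper triangular matrices with diagonal blocks of sizes $k$ and $n-k$; the class of a matrix corresponds to the span of its first $k$ columns. $U_k^-\subset U^-$ is the subgroup of block matrices $\begin{pmatrix}\mathbb 1_k&0\\ *&\mathbb 1_{n-k}\end{pmatrix}$; it maps isomorphically to a dense open subset of $SL_n/P_k$. A sequence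 $S=(\beta_1,\dots,\beta_d)$ of $d=k(n-k)$ positive roots of type $\mathtt A_{n-1}$ (repetitions allowed) is called birational for $\mathrm{Gr}(k,\mathbb C^n)$ if the multiplication map $\psi_S:U_{-\beta_1}\times\dots\times U_{-\beta_d}\to U^-$ has image birational to $U_k^-$, in the sense that the map $\mathbb A^d\to \mathrm{Gr}(k,\mathbb C^n)$, $(z_1,\dots,z_d)\mapsto$ (span of the first $k$ columns of $\exp(z_1f_{\beta_1})\cdots\exp(z_df_{\beta_d})$), is birational (equivalently, the pullback $\psi_S^*:\mathbb C(\mathrm{Gr}(k,\mathbb C^n))\to\mathbb C(z_1,\dots,z_d)$ is a field isomorphism). *)

theory Defs
  imports "HOL-Analysis.Abstract_Topology" "Jordan_Normal_Form.DL_Rank"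
begin

section \<open>Complex varieties as spaces with functions\<close>

text \<open>
  A variety is given by its set of closed points with the Zariski topology, together with the
  predicate telling which functions are regular on which open sets. For \<open>regular X U f\<close> only the
  values of \<open>f\<close> on \<open>U\<close> matter.
\<close>

record 'a variety =
  zariski :: "'a topology"
  regular :: "'a set \<Rightarrow> ('a \<Rightarrow> complex) \<Rightarrow> bool"

text \<open>
  \<open>poly_functions C\<close> is the algebra of functions generated by the set \<open>C\<close> of coordinate functions of
  the ambient affine space.
\<close>

inductive_set poly_functions :: "('a \<Rightarrow> complex) set \<Rightarrow> ('a \<Rightarrow> complex) set"
  for C :: "('a \<Rightarrow> complex) set" where
  const: "(\<lambda>_. c) \<in> poly_functions C"
| coord: "f \<in> C \<Longrightarrow> f \<in> poly_functions C"
| add: "f \<in> poly_functions C \<Longrightarrow> g \<in> poly_functions C \<Longrightarrow> (\<lambda>x. f x + g x) \<in> poly_functions C"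
| mult: "f \<in> poly_functions C \<Longrightarrow> g \<in> poly_functions C \<Longrightarrow> (\<lambda>x. f x * g x) \<in> poly_functions C"

text \<open>
  The variety structure on a Zariski closed subset \<open>X\<close> of an affine space with coordinates \<open>C\<close>. The
  principal open sets are a basis of the topology (they are closed under intersection, and
  \<open>X\<close> is one of them), and regular functions are locally quotients of polynomials.
\<close>

definition principal_open :: "'a set \<Rightarrow> ('a \<Rightarrow> complex) \<Rightarrow> 'a set" where
  "principal_open X f = {x \<in> X. f x \<noteq> 0}"

definition affine_variety :: "'a set \<Rightarrow> ('a \<Rightarrow> complex) set \<Rightarrow> 'a variety" where
  "affine_variety X C =
    (let T = topology_generated_by (principal_open X ` poly_functions C) in
     \<lparr> zariski = T,
       regular = (\<lambda>U f. \<forall>x\<in>U. \<exists>W. \<exists>p\<in>poly_functions C. \<exists>q\<in>poly_functions C.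
         openin T W \<and> x \<in> W \<and> W \<subseteq> U \<and> (\<forall>y\<in>W. q y \<noteq> 0 \<and> f y = p y / q y)) \<rparr>)"

lemma topspace_affine: "topspace (zariski (affine_variety X C)) = X"
proof -
  have "X = principal_open X (\<lambda>_. 1)" by (auto simp: principal_open_def)
  moreover have "(\<lambda>_. 1) \<in> poly_functions C" by (rule poly_functions.const)
  ultimately show ?thesis by (auto simp: affine_variety_def principal_open_def Let_def)
qed

text \<open>
  The quotient of a variety \<open>X\<close> along a map \<open>\<pi>\<close> onto a set \<open>Y\<close>: a subset is open iff its preimage is,
  and a function is regular iff its pullback is. For \<open>X\<close> an algebraic group over the complex numbers
  and \<open>\<pi>\<close> with fibres the cosets of a closed subgroup, this is the homogeneous space.
\<close>

definition quotient_variety :: "'a variety \<Rightarrow> 'b set \<Rightarrow> ('a \<Rightarrow> 'b) \<Rightarrow> 'b variety" where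
  "quotient_variety X Y \<pi> =
    \<lparr> zariski = topology (\<lambda>V. V \<subseteq> Y \<and> openin (zariski X) {x \<in> topspace (zariski X). \<pi> x \<in> V}),
      regular = (\<lambda>V f. regular X {x \<in> topspace (zariski X). \<pi> x \<in> V} (f \<circ> \<pi>)) \<rparr>"

lemma istopology_quotient:
  "istopology (\<lambda>V. V \<subseteq> Y \<and> openin T {x \<in> topspace T. \<pi> x \<in> V})"
  unfolding istopology_def
proof (intro conjI allI impI)
  fix S S'
  assume "S \<subseteq> Y \<and> openin T {x \<in> topspace T. \<pi> x \<in> S}"
    and "S' \<subseteq> Y \<and> openin T {x \<in> topspace T. \<pi> x \<in> S'}"
  moreover have "{x \<in> topspace T. \<pi> x \<in> S \<inter> S'} =
      {x \<in> topspace T. \<pi> x \<in> S} \<inter> {x \<in> topspace T. \<pi> x \<in> S'}" by auto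
  ultimately show "S \<inter> S' \<subseteq> Y" "openin T {x \<in> topspace T. \<pi> x \<in> S \<inter> S'}"
    by auto
next
  fix K
  assume *: "\<forall>S\<in>K. S \<subseteq> Y \<and> openin T {x \<in> topspace T. \<pi> x \<in> S}"
  then show "\<Union>K \<subseteq> Y" by auto
  have "{x \<in> topspace T. \<pi> x \<in> \<Union>K} = (\<Union>S\<in>K. {x \<in> topspace T. \<pi> x \<in> S})" by auto
  then show "openin T {x \<in> topspace T. \<pi> x \<in> \<Union>K}" using * by auto
qed

text \<open>Morphisms between open subvarieties \<open>U\<close> of \<open>X\<close> and \<open>V\<close> of \<open>Y\<close>.\<close>

definition morphism_on ::
    "'a variety \<Rightarrow> 'a set \<Rightarrow> 'b variety \<Rightarrow> 'b set \<Rightarrow> ('a \<Rightarrow> 'b) \<Rightarrow> bool" where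
  "morphism_on X U Y V \<phi> \<longleftrightarrow>
    continuous_map (subtopology (zariski X) U) (subtopology (zariski Y) V) \<phi> \<and>
    (\<forall>W f. openin (zariski Y) W \<and> W \<subseteq> V \<and> regular Y W f \<longrightarrow> regular X {x \<in> U. \<phi> x \<in> W} (f \<circ> \<phi>))"

text \<open>
  The notion below is meant for irreducible \<open>X\<close> and \<open>Y\<close>, where nonempty open subsets are dense.
\<close>

definition birational_morphism :: "'a variety \<Rightarrow> 'b variety \<Rightarrow> ('a \<Rightarrow> 'b) \<Rightarrow> bool" where
  "birational_morphism X Y \<phi> \<longleftrightarrow>
    morphism_on X (topspace (zariski X)) Y (topspace (zariski Y)) \<phi> \<and>
    (\<exists>U V \<psi>. openin (zariski X) U \<and> U \<noteq> {} \<and> openin (zariski Y) V \<and> V \<noteq> {} \<and>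
      morphism_on X U Y V \<phi> \<and> morphism_on Y V X U \<psi> \<and>
      (\<forall>x\<in>U. \<psi> (\<phi> x) = x) \<and> (\<forall>y\<in>V. \<phi> (\<psi> y) = y))"


section \<open>Affine space, the special linear group and the Grassmannian\<close>

definition affine_space :: "nat \<Rightarrow> complex vec variety" where
  "affine_space d = affine_variety (carrier_vec d) {(\<lambda>v. v $ l) | l. l < d}"

definition SL :: "nat \<Rightarrow> complex mat set" where
  "SL n = {g \<in> carrier_mat n n. det g = 1}"

definition SL_variety :: "nat \<Rightarrow> complex mat variety" where
  "SL_variety n = affine_variety (SL n) {(\<lambda>g. g $$ (r, c)) | r c. r < n \<and> c < n}"

definition first_cols_span :: "nat \<Rightarrow> nat \<Rightarrow> complex mat \<Rightarrow> complex vec set" where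
  "first_cols_span k n g =
    LinearCombinations.module.span class_ring (module_vec TYPE(complex) n) (set (take k (cols g)))"

definition subspaces_of_dim :: "nat \<Rightarrow> nat \<Rightarrow> complex vec set set" where
  "subspaces_of_dim k n =
    {W. VectorSpace.subspace class_ring W (module_vec TYPE(complex) n) \<and>
        vectorspace.dim class_ring ((module_vec TYPE(complex) n)\<lparr>carrier := W\<rparr>) = k}"

text \<open>
  The Grassmannian with its structure as \<open>SL n\<close> modulo the parabolic subgroup of block upper
  triangular matrices: two elements of \<open>SL n\<close> lie in the same coset iff their first \<open>k\<close> columns have
  the same span.
\<close>

definition Grassmannian :: "nat \<Rightarrow> nat \<Rightarrow> complex vec set variety" where
  "Grassmannian k n = quotient_variety (SL_variety n) (subspaces_of_dim k n) (first_cols_span k n)"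


lemma first_cols_span_subspace:
  assumes "g \<in> SL n" and "k \<le> n"
  shows "first_cols_span k n g \<in> subspaces_of_dim k n"
proof -
  interpret vec_space "TYPE(complex)" n .
  have g: "g \<in> carrier_mat n n" and "det g \<noteq> 0" using assms by (auto simp: SL_def)
  then have r: "rank g = n" using det_rank_iff by auto
  have d: "distinct (cols g)" using r g non_distinct_low_rank by fastforce
  have li: "lin_indpt (set (cols g))" using full_rank_lin_indpt[OF g r d] .
  let ?A = "set (take k (cols g))"
  have sub: "?A \<subseteq> set (cols g)" by (rule set_take_subset)
  then have c: "?A \<subseteq> carrier V" using cols_dim[of g] g by auto
  have liA: "lin_indpt ?A" using subset_li_is_li[OF li sub] .
  have cardA: "card ?A = k" using d g assms(2) by (simp add: distinct_card)
  have sp: "VectorSpace.subspace class_ring (span ?A) V" using c by (intro span_is_subspace) auto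
  have vs: "vectorspace class_ring (vs (span ?A))" using subspace_is_vs[OF sp] .
  have "maximal ?A (\<lambda>T. T \<subseteq> ?A \<and> lin_indpt T)" using liA by (auto simp: maximal_def)
  then have "vectorspace.dim class_ring (vs (span ?A)) = card ?A"
    using dim_span[of ?A ?A] c by auto
  then show ?thesis using sp cardA by (auto simp: first_cols_span_def subspaces_of_dim_def)
qed

lemma topspace_SL: "topspace (zariski (SL_variety n)) = SL n"
  by (simp add: SL_variety_def topspace_affine)

lemma topspace_Grassmannian:
  assumes "k \<le> n"
  shows "topspace (zariski (Grassmannian k n)) = subspaces_of_dim k n"
proof -
  have o: "openin (zariski (Grassmannian k n)) V \<longleftrightarrow> V \<subseteq> subspaces_of_dim k n \<and>
     openin (zariski (SL_variety n)) {g \<in> SL n. first_cols_span k n g \<in> V}" for V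
    using topology_inverse'[OF istopology_quotient[of "subspaces_of_dim k n"
        "zariski (SL_variety n)" "first_cols_span k n"]]
    by (simp add: Grassmannian_def quotient_variety_def topspace_SL)
  have "{g \<in> SL n. first_cols_span k n g \<in> subspaces_of_dim k n} = topspace (zariski (SL_variety n))"
    using first_cols_span_subspace assms by (auto simp: topspace_SL)
  then have "openin (zariski (Grassmannian k n)) (subspaces_of_dim k n)"
    unfolding o by simp
  then show ?thesis using o by (metis openin_subset openin_topspace subset_antisym)
qed


section \<open>Birational sequences\<close>

text \<open>
  The pair \<open>(i, j)\<close> with \<open>1 \<le> i < j \<le> n\<close> stands for the positive root \<open>\<epsilon>\<^sub>i - \<epsilon>\<^sub>j\<close> of type \<open>A\<close> of rank
  \<open>n - 1\<close>. Matrix indices start at 0, hence the shift in \<open>root_matrix\<close>.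
\<close>

type_synonym root = "nat \<times> nat"

definition positive_roots :: "nat \<Rightarrow> root set" where
  "positive_roots n = {(i, j). 1 \<le> i \<and> i < j \<and> j \<le> n}"

definition root_matrix :: "nat \<Rightarrow> root \<Rightarrow> complex mat" where
  "root_matrix n = (\<lambda>(i, j). mat n n (\<lambda>(r, c). if r = j - 1 \<and> c = i - 1 then 1 else 0))"

text \<open>As \<open>root_matrix n \<beta>\<close> squares to zero, the exponential series stops after the linear term.\<close>

definition exp_root :: "nat \<Rightarrow> root \<Rightarrow> complex \<Rightarrow> complex mat" where
  "exp_root n \<beta> z = 1\<^sub>m n + z \<cdot>\<^sub>m root_matrix n \<beta>"

lemma root_matrix_square:
  assumes "\<beta> \<in> positive_roots n"
  shows "root_matrix n \<beta> * root_matrix n \<beta> = 0\<^sub>m n n"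
  using assms
  by (intro eq_matI) (auto simp: root_matrix_def positive_roots_def scalar_prod_def intro!: sum.neutral,
     linarith)

definition root_product :: "nat \<Rightarrow> root list \<Rightarrow> complex vec \<Rightarrow> complex mat" where
  "root_product n S z =
    foldr (*) (map (\<lambda>l. exp_root n (S ! l) (z $ l)) [0..<length S]) (1\<^sub>m n)"

definition birational_sequence :: "nat \<Rightarrow> nat \<Rightarrow> root list \<Rightarrow> bool" where
  "birational_sequence k n S \<longleftrightarrow>
    set S \<subseteq> positive_roots n \<and> length S = k * (n - k) \<and>
    birational_morphism (affine_space (k * (n - k))) (Grassmannian k n)
      (\<lambda>z. first_cols_span k n (root_product n S z))"

end

theory Submission
  imports Defs
begin

text \<open>
  Let \<open>A(z)\<close> be the first \<open>k\<close> columns of the product belonging to \<open>S\<close>. The factors belonging to the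
  prepended roots multiply to \<open>1 + (\<Sum>l. w\<^sub>l f\<^sub>l)\<close>, where \<open>f\<^sub>l\<close> adds row \<open>i\<^sub>l\<close> to the new bottom row. So
  for the extended sequence the first \<open>k\<close> columns are \<open>A(z)\<close> with the additional bottom row
  \<open>\<Sum>l. w\<^sub>l A(z)\<^bsub>i\<^sub>l\<^esub>\<close> (\<open>root_prod_extended\<close>): their span is the graph, over the span \<open>W\<close> of the columns of
  \<open>A(z)\<close>, of the linear functional \<open>\<Sum>l. w\<^sub>l x\<^bsub>i\<^sub>l\<^esub>\<close>. Conversely, consider a \<open>k\<close>-dimensional subspace whose
  projection \<open>W\<close> to the first \<open>n\<close> coordinates has a nonzero Pluecker coordinate at \<open>i\<^sub>1, \<dots>, i\<^sub>k\<close>. The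
  coordinate functions \<open>x\<^bsub>i\<^sub>1\<^esub>, \<dots>, x\<^bsub>i\<^sub>k\<^esub>\<close> then form a basis of the dual of \<open>W\<close>. Hence the subspace is the
  graph of a unique such functional, whose coefficients \<open>w\<close> are rational by Cramer's rule, while \<open>z\<close>
  is recovered from \<open>W\<close> by the inverse of the birational map of \<open>S\<close>.

  As the Grassmannian is a quotient of the special linear group, this inverse is described on
  matrices \<open>g\<close>: \<open>chart_lift\<close> represents the projection of the subspace of \<open>g\<close> by a matrix of
  determinant \<open>1\<close>, and \<open>bottom_functional\<close> is the functional. Both are rational in the entries of \<open>g\<close>.
  By \<open>chart_span_invariant\<close> they depend only on the subspace, and by \<open>chart_span_determined\<close> they
  determine it. The open sets between which the two maps are mutually inverse are nonempty because
  the Pluecker coordinate does not vanish identically on any nonempty open subset of the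
  Grassmannian (\<open>chart_dense\<close>).
\<close>

section \<open>Regular functions on affine varieties\<close>

lemma regular_affine_iff:
  "regular (affine_variety X C) U f \<longleftrightarrow>
    (\<forall>x\<in>U. \<exists>W. \<exists>p\<in>poly_functions C. \<exists>q\<in>poly_functions C.
       openin (zariski (affine_variety X C)) W \<and> x \<in> W \<and> W \<subseteq> U \<and>
       (\<forall>y\<in>W. q y \<noteq> 0 \<and> f y = p y / q y))"
  by (simp add: affine_variety_def Let_def)

lemma openin_principal_open:
  "p \<in> poly_functions C \<Longrightarrow> openin (zariski (affine_variety X C)) (principal_open X p)"
  by (auto simp: affine_variety_def Let_def intro!: topology_generated_by_Basis)

lemma open_subset_affine: "openin (zariski (affine_variety X C)) U \<Longrightarrow> U \<subseteq> X"
  using openin_subset[of "zariski (affine_variety X C)" U] by (simp add: topspace_affine)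

lemma openin_affine_topspace: "openin (zariski (affine_variety X C)) X"
  using openin_topspace[of "zariski (affine_variety X C)"] by (simp add: topspace_affine)

text \<open>
  The topology is only generated by the principal open sets; since
  \<open>principal_open X p \<inter> principal_open X q = principal_open X (p * q)\<close> they are even a basis.
\<close>

lemma principal_open_basis:
  assumes "openin (zariski (affine_variety X C)) U" and "x \<in> U"
  shows "\<exists>p\<in>poly_functions C. x \<in> principal_open X p \<and> principal_open X p \<subseteq> U"
proof -
  have "generate_topology_on (principal_open X ` poly_functions C) U"
    using assms(1) by (simp add: affine_variety_def Let_def openin_topology_generated_by_iff)
  then show ?thesis using assms(2)
  proof (induction arbitrary: x)
    case (Int a b)
    obtain p where p: "p \<in> poly_functions C" "x \<in> principal_open X p" "principal_open X p \<subseteq> a"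
      using Int by blast
    obtain q where q: "q \<in> poly_functions C" "x \<in> principal_open X q" "principal_open X q \<subseteq> b"
      using Int by blast
    have "(\<lambda>x. p x * q x) \<in> poly_functions C" using p q by (intro poly_functions.mult)
    moreover have "principal_open X (\<lambda>x. p x * q x) = principal_open X p \<inter> principal_open X q"
      by (auto simp: principal_open_def)
    ultimately show ?case using p q by (metis IntI Int_mono)
  next
    case (UN K)
    then obtain k where "k \<in> K" "x \<in> k" by blast
    then show ?case using UN.IH[of k x] by blast
  qed auto
qed

lemma regular_cong:
  assumes "regular (affine_variety X C) U f" and "\<And>x. x \<in> U \<Longrightarrow> f x = g x"
  shows "regular (affine_variety X C) U g"
  unfolding regular_affine_iff
proof
  fix x assume "x \<in> U"
  then obtain W p q where "p \<in> poly_functions C" "q \<in> poly_functions C"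
       "openin (zariski (affine_variety X C)) W" "x \<in> W" "W \<subseteq> U"
       "\<forall>y\<in>W. q y \<noteq> 0 \<and> f y = p y / q y"
    using assms(1) unfolding regular_affine_iff by meson
  then show "\<exists>W. \<exists>p\<in>poly_functions C. \<exists>q\<in>poly_functions C.
       openin (zariski (affine_variety X C)) W \<and> x \<in> W \<and> W \<subseteq> U \<and>
       (\<forall>y\<in>W. q y \<noteq> 0 \<and> g y = p y / q y)"
    using assms(2) by - (rule exI[of _ W], rule bexI[of _ p], rule bexI[of _ q], auto simp: subset_iff)
qed

lemma regular_local:
  assumes "\<And>x. x \<in> U \<Longrightarrow> \<exists>N. x \<in> N \<and> N \<subseteq> U \<and> regular (affine_variety X C) N f"
  shows "regular (affine_variety X C) U f"
  unfolding regular_affine_iff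
proof
  fix x assume "x \<in> U"
  then obtain N where N: "x \<in> N" "N \<subseteq> U" "regular (affine_variety X C) N f" using assms by blast
  then show "\<exists>W. \<exists>p\<in>poly_functions C. \<exists>q\<in>poly_functions C.
       openin (zariski (affine_variety X C)) W \<and> x \<in> W \<and> W \<subseteq> U \<and>
       (\<forall>y\<in>W. q y \<noteq> 0 \<and> f y = p y / q y)"
    unfolding regular_affine_iff by (meson order_trans)
qed

lemma regular_subset:
  assumes "regular (affine_variety X C) U f" and "openin (zariski (affine_variety X C)) V" and "V \<subseteq> U"
  shows "regular (affine_variety X C) V f"
  unfolding regular_affine_iff
proof
  fix x assume "x \<in> V"
  then obtain W p q where *: "p \<in> poly_functions C" "q \<in> poly_functions C"
       "openin (zariski (affine_variety X C)) W" "x \<in> W" "W \<subseteq> U"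
       "\<forall>y\<in>W. q y \<noteq> 0 \<and> f y = p y / q y"
    using assms unfolding regular_affine_iff by (meson subsetD)
  then have "openin (zariski (affine_variety X C)) (W \<inter> V)" using assms by auto
  with * \<open>x \<in> V\<close> show "\<exists>W. \<exists>p\<in>poly_functions C. \<exists>q\<in>poly_functions C.
       openin (zariski (affine_variety X C)) W \<and> x \<in> W \<and> W \<subseteq> V \<and>
       (\<forall>y\<in>W. q y \<noteq> 0 \<and> f y = p y / q y)"
    by - (rule exI[of _ "W \<inter> V"], rule bexI[of _ p], rule bexI[of _ q], auto)
qed

lemma regular_const:
  assumes "openin (zariski (affine_variety X C)) U"
  shows "regular (affine_variety X C) U (\<lambda>_. c)"
  unfolding regular_affine_iff
proof
  fix x assume "x \<in> U"
  then show "\<exists>W. \<exists>p\<in>poly_functions C. \<exists>q\<in>poly_functions C.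
       openin (zariski (affine_variety X C)) W \<and> x \<in> W \<and> W \<subseteq> U \<and>
       (\<forall>y\<in>W. q y \<noteq> 0 \<and> c = p y / q y)"
    using assms
    by - (rule exI[of _ U], rule bexI[of _ "\<lambda>_. c"], rule bexI[of _ "\<lambda>_. 1"],
        auto intro: poly_functions.const)
qed

lemma regular_coord:
  assumes "openin (zariski (affine_variety X C)) U" and "f \<in> C"
  shows "regular (affine_variety X C) U f"
  unfolding regular_affine_iff
proof
  fix x assume "x \<in> U"
  then show "\<exists>W. \<exists>p\<in>poly_functions C. \<exists>q\<in>poly_functions C.
       openin (zariski (affine_variety X C)) W \<and> x \<in> W \<and> W \<subseteq> U \<and>
       (\<forall>y\<in>W. q y \<noteq> 0 \<and> f y = p y / q y)"
    using assms
    by - (rule exI[of _ U], rule bexI[of _ f], rule bexI[of _ "\<lambda>_. 1"],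
        auto intro: poly_functions.const poly_functions.coord)
qed

text \<open>
  Two local presentations \<open>p / q\<close> and \<open>p' / q'\<close> hold simultaneously on the intersection of their
  domains, so a closure property of regular functions reduces to the same property of fractions.
\<close>

lemma regular_binop:
  assumes f: "regular (affine_variety X C) U f" and g: "regular (affine_variety X C) U g"
    and op: "\<And>p q p' q'. p \<in> poly_functions C \<Longrightarrow> q \<in> poly_functions C \<Longrightarrow>
        p' \<in> poly_functions C \<Longrightarrow> q' \<in> poly_functions C \<Longrightarrow>
        \<exists>P\<in>poly_functions C. \<exists>Q\<in>poly_functions C. \<forall>y. q y \<noteq> 0 \<longrightarrow> q' y \<noteq> 0 \<longrightarrow>
          Q y \<noteq> 0 \<and> F (p y / q y) (p' y / q' y) = P y / Q y"
  shows "regular (affine_variety X C) U (\<lambda>x. F (f x) (g x))"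
  unfolding regular_affine_iff
proof
  fix x assume "x \<in> U"
  obtain W p q where 1: "p \<in> poly_functions C" "q \<in> poly_functions C"
       "openin (zariski (affine_variety X C)) W" "x \<in> W" "W \<subseteq> U"
       "\<forall>y\<in>W. q y \<noteq> 0 \<and> f y = p y / q y"
    using f \<open>x \<in> U\<close> unfolding regular_affine_iff by meson
  obtain W' p' q' where 2: "p' \<in> poly_functions C" "q' \<in> poly_functions C"
       "openin (zariski (affine_variety X C)) W'" "x \<in> W'" "W' \<subseteq> U"
       "\<forall>y\<in>W'. q' y \<noteq> 0 \<and> g y = p' y / q' y"
    using g \<open>x \<in> U\<close> unfolding regular_affine_iff by meson
  obtain P Q where "P \<in> poly_functions C" "Q \<in> poly_functions C"
    "\<forall>y. q y \<noteq> 0 \<longrightarrow> q' y \<noteq> 0 \<longrightarrow> Q y \<noteq> 0 \<and> F (p y / q y) (p' y / q' y) = P y / Q y"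
    using op[OF 1(1,2) 2(1,2)] by meson
  moreover have "openin (zariski (affine_variety X C)) (W \<inter> W')" using 1 2 by auto
  ultimately show "\<exists>W. \<exists>p\<in>poly_functions C. \<exists>q\<in>poly_functions C.
       openin (zariski (affine_variety X C)) W \<and> x \<in> W \<and> W \<subseteq> U \<and>
       (\<forall>y\<in>W. q y \<noteq> 0 \<and> F (f y) (g y) = p y / q y)"
    using 1(4-6) 2(4-6)
    by - (rule exI[of _ "W \<inter> W'"], rule bexI[of _ P], rule bexI[of _ Q], auto)
qed

lemma regular_add:
  assumes "regular (affine_variety X C) U f" and "regular (affine_variety X C) U g"
  shows "regular (affine_variety X C) U (\<lambda>x. f x + g x)"
proof (rule regular_binop[OF assms])
  fix p q p' q' assume *: "p \<in> poly_functions C" "q \<in> poly_functions C"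
    "p' \<in> poly_functions C" "q' \<in> poly_functions C"
  show "\<exists>P\<in>poly_functions C. \<exists>Q\<in>poly_functions C. \<forall>y. q y \<noteq> 0 \<longrightarrow> q' y \<noteq> 0 \<longrightarrow>
          Q y \<noteq> 0 \<and> p y / q y + p' y / q' y = P y / Q y"
    using * by (intro bexI[of _ "\<lambda>y. p y * q' y + p' y * q y"] bexI[of _ "\<lambda>y. q y * q' y"])
      (auto simp: add_frac_eq intro: poly_functions.add poly_functions.mult)
qed

lemma regular_mult:
  assumes "regular (affine_variety X C) U f" and "regular (affine_variety X C) U g"
  shows "regular (affine_variety X C) U (\<lambda>x. f x * g x)"
proof (rule regular_binop[OF assms])
  fix p q p' q' assume *: "p \<in> poly_functions C" "q \<in> poly_functions C"
    "p' \<in> poly_functions C" "q' \<in> poly_functions C"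
  show "\<exists>P\<in>poly_functions C. \<exists>Q\<in>poly_functions C. \<forall>y. q y \<noteq> 0 \<longrightarrow> q' y \<noteq> 0 \<longrightarrow>
          Q y \<noteq> 0 \<and> p y / q y * (p' y / q' y) = P y / Q y"
    using * by (intro bexI[of _ "\<lambda>y. p y * p' y"] bexI[of _ "\<lambda>y. q y * q' y"])
      (auto intro: poly_functions.mult)
qed

lemma regular_sum:
  assumes "openin (zariski (affine_variety X C)) U"
    and "\<And>i. i \<in> I \<Longrightarrow> regular (affine_variety X C) U (f i)"
  shows "regular (affine_variety X C) U (\<lambda>x. \<Sum>i\<in>I. f i x)"
  using assms by (induction I rule: infinite_finite_induct) (auto intro: regular_const regular_add)

lemma regular_prod:
  assumes "openin (zariski (affine_variety X C)) U"
    and "\<And>i. i \<in> I \<Longrightarrow> regular (affine_variety X C) U (f i)"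
  shows "regular (affine_variety X C) U (\<lambda>x. \<Prod>i\<in>I. f i x)"
  using assms by (induction I rule: infinite_finite_induct) (auto intro: regular_const regular_mult)

lemma regular_poly_function:
  assumes "p \<in> poly_functions D" and "openin (zariski (affine_variety X C)) U"
    and "\<And>c. c \<in> D \<Longrightarrow> regular (affine_variety X C) U (\<lambda>x. c (F x))"
  shows "regular (affine_variety X C) U (\<lambda>x. p (F x))"
  using assms by (induction) (auto intro: regular_const regular_add regular_mult)

text \<open>
  Where \<open>f = p / q\<close>, the function \<open>f\<close> vanishes exactly where the numerator \<open>p\<close> does.
\<close>

lemma openin_regular_nonzero:
  assumes f: "regular (affine_variety X C) U f"
  shows "openin (zariski (affine_variety X C)) {x \<in> U. f x \<noteq> 0}"
proof (subst openin_subopen, intro ballI)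
  fix x assume x: "x \<in> {x \<in> U. f x \<noteq> 0}"
  then obtain W p q where *: "p \<in> poly_functions C" "q \<in> poly_functions C"
       "openin (zariski (affine_variety X C)) W" "x \<in> W" "W \<subseteq> U"
       "\<forall>y\<in>W. q y \<noteq> 0 \<and> f y = p y / q y"
    using f unfolding regular_affine_iff by blast
  have "openin (zariski (affine_variety X C)) (W \<inter> principal_open X p)"
    using * by (intro openin_Int openin_principal_open)
  moreover have "x \<in> W \<inter> principal_open X p" "W \<inter> principal_open X p \<subseteq> {x \<in> U. f x \<noteq> 0}"
    using * x open_subset_affine[OF *(3)] by (auto simp: principal_open_def)
  ultimately show "\<exists>T. openin (zariski (affine_variety X C)) T \<and> x \<in> T \<and> T \<subseteq> {x \<in> U. f x \<noteq> 0}"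
    by blast
qed

lemma regular_inverse:
  assumes f: "regular (affine_variety X C) U f" and "\<And>x. x \<in> U \<Longrightarrow> f x \<noteq> 0"
  shows "regular (affine_variety X C) U (\<lambda>x. inverse (f x))"
  unfolding regular_affine_iff
proof
  fix x assume x: "x \<in> U"
  then obtain W p q where *: "p \<in> poly_functions C" "q \<in> poly_functions C"
       "openin (zariski (affine_variety X C)) W" "x \<in> W" "W \<subseteq> U"
       "\<forall>y\<in>W. q y \<noteq> 0 \<and> f y = p y / q y"
    using f unfolding regular_affine_iff by meson
  then show "\<exists>W. \<exists>p\<in>poly_functions C. \<exists>q\<in>poly_functions C.
       openin (zariski (affine_variety X C)) W \<and> x \<in> W \<and> W \<subseteq> U \<and>
       (\<forall>y\<in>W. q y \<noteq> 0 \<and> inverse (f y) = p y / q y)"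
    using assms(2) by - (rule exI[of _ W], rule bexI[of _ q], rule bexI[of _ p], auto simp: subset_iff)
qed

lemma regular_divide:
  assumes "regular (affine_variety X C) U f" and "regular (affine_variety X C) U g"
    and "\<And>x. x \<in> U \<Longrightarrow> g x \<noteq> 0"
  shows "regular (affine_variety X C) U (\<lambda>x. f x / g x)"
  unfolding divide_inverse using assms by (intro regular_mult regular_inverse)

lemma regular_det:
  assumes U: "openin (zariski (affine_variety X C)) U"
    and A: "\<And>x. x \<in> U \<Longrightarrow> A x \<in> carrier_mat m m"
    and reg: "\<And>r c. r < m \<Longrightarrow> c < m \<Longrightarrow> regular (affine_variety X C) U (\<lambda>x. A x $$ (r, c))"
  shows "regular (affine_variety X C) U (\<lambda>x. det (A x))"
proof (rule regular_cong)
  show "regular (affine_variety X C) U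
     (\<lambda>x. \<Sum>p\<in>{p. p permutes {0..<m}}. signof p * (\<Prod>i\<in>{0..<m}. A x $$ (i, p i)))"
    using U permutes_in_image by (intro regular_sum regular_mult regular_prod regular_const reg) fastforce+
qed (auto simp: det_def'[OF A])

section \<open>Morphisms given by regular functions\<close>

text \<open>
  A map into an affine variety is a morphism as soon as its coordinates are regular: by
  \<open>regular_poly_function\<close> it pulls polynomials back to regular functions, hence principal open sets
  to open sets, and quotients of polynomials to regular functions.
\<close>

lemma openin_regular_preimage:
  assumes U: "openin (zariski (affine_variety X C)) U"
    and F: "\<And>x. x \<in> U \<Longrightarrow> F x \<in> Y"
    and reg: "\<And>c. c \<in> D \<Longrightarrow> regular (affine_variety X C) U (\<lambda>x. c (F x))"
    and W: "openin (zariski (affine_variety Y D)) W"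
  shows "openin (zariski (affine_variety X C)) {x \<in> U. F x \<in> W}"
proof (subst openin_subopen, intro ballI)
  fix x assume x: "x \<in> {x \<in> U. F x \<in> W}"
  then obtain p where p: "p \<in> poly_functions D" "F x \<in> principal_open Y p" "principal_open Y p \<subseteq> W"
    using principal_open_basis[OF W, of "F x"] by blast
  have "openin (zariski (affine_variety X C)) {x \<in> U. p (F x) \<noteq> 0}"
    by (intro openin_regular_nonzero regular_poly_function[OF p(1) U] reg)
  moreover have "x \<in> {x \<in> U. p (F x) \<noteq> 0}" "{x \<in> U. p (F x) \<noteq> 0} \<subseteq> {x \<in> U. F x \<in> W}"
    using p x F by (auto simp: principal_open_def)
  ultimately show "\<exists>T. openin (zariski (affine_variety X C)) T \<and> x \<in> T \<and> T \<subseteq> {x \<in> U. F x \<in> W}"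
    by blast
qed

lemma regular_pullback:
  assumes U: "openin (zariski (affine_variety X C)) U"
    and F: "\<And>x. x \<in> U \<Longrightarrow> F x \<in> Y"
    and reg: "\<And>c. c \<in> D \<Longrightarrow> regular (affine_variety X C) U (\<lambda>x. c (F x))"
    and f: "regular (affine_variety Y D) W f"
  shows "regular (affine_variety X C) {x \<in> U. F x \<in> W} (\<lambda>x. f (F x))"
proof (rule regular_local)
  fix x assume x: "x \<in> {x \<in> U. F x \<in> W}"
  then obtain N p q where *: "p \<in> poly_functions D" "q \<in> poly_functions D"
       "openin (zariski (affine_variety Y D)) N" "F x \<in> N" "N \<subseteq> W"
       "\<forall>y\<in>N. q y \<noteq> 0 \<and> f y = p y / q y"
    using f unfolding regular_affine_iff by blast
  let ?N = "{x \<in> U. F x \<in> N}"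
  have N: "openin (zariski (affine_variety X C)) ?N"
    by (rule openin_regular_preimage[where F=F, OF U F reg *(3)])
  have r: "regular (affine_variety X C) ?N (\<lambda>x. c (F x))" if "c \<in> D" for c
    by (rule regular_subset[OF reg[OF that] N]) auto
  have "regular (affine_variety X C) ?N (\<lambda>x. p (F x) / q (F x))"
    by (intro regular_divide regular_poly_function[OF *(1) N] regular_poly_function[OF *(2) N] r)
       (use * in auto)
  then have "regular (affine_variety X C) ?N (\<lambda>x. f (F x))"
    by (rule regular_cong) (use * in auto)
  then show "\<exists>N. x \<in> N \<and> N \<subseteq> {x \<in> U. F x \<in> W} \<and> regular (affine_variety X C) N (\<lambda>x. f (F x))"
    using x * by (intro exI[of _ ?N]) auto
qed

lemma morphism_onI:
  assumes "openin (zariski X) U" and "\<And>x. x \<in> U \<Longrightarrow> \<phi> x \<in> V" and "V \<subseteq> topspace (zariski Y)"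
    and op: "\<And>W. openin (zariski Y) W \<Longrightarrow> openin (zariski X) {x \<in> U. \<phi> x \<in> W}"
    and reg: "\<And>W f. openin (zariski Y) W \<Longrightarrow> W \<subseteq> V \<Longrightarrow> regular Y W f \<Longrightarrow>
        regular X {x \<in> U. \<phi> x \<in> W} (\<lambda>x. f (\<phi> x))"
  shows "morphism_on X U Y V \<phi>"
  unfolding morphism_on_def
proof (intro conjI allI impI)
  have "topspace (subtopology (zariski X) U) = U"
    using openin_subset[OF assms(1)] by auto
  moreover have "openin (subtopology (zariski X) U) {x \<in> U. \<phi> x \<in> W}"
    if W: "openin (subtopology (zariski Y) V) W" for W
  proof -
    obtain T where T: "openin (zariski Y) T" "W = T \<inter> V" using W unfolding openin_subtopology by blast
    then have "{x \<in> U. \<phi> x \<in> W} = {x \<in> U. \<phi> x \<in> T} \<inter> U" using assms(2) by auto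
    then show ?thesis using op[OF T(1)] by (auto simp: openin_subtopology)
  qed
  ultimately show "continuous_map (subtopology (zariski X) U) (subtopology (zariski Y) V) \<phi>"
    using assms(2,3) by (auto simp: continuous_map)
  show "regular X {x \<in> U. \<phi> x \<in> W} (f \<circ> \<phi>)"
    if "openin (zariski Y) W \<and> W \<subseteq> V \<and> regular Y W f" for W f
    using reg that by (simp add: o_def)
qed

lemma morphism_on_maps_to:
  assumes "morphism_on X U Y V \<phi>" and "U \<subseteq> topspace (zariski X)" and "x \<in> U"
  shows "\<phi> x \<in> V"
proof -
  have "x \<in> topspace (subtopology (zariski X) U)" using assms by auto
  then have "\<phi> x \<in> topspace (subtopology (zariski Y) V)"
    using assms(1) by (auto simp: morphism_on_def continuous_map)
  then show ?thesis by auto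
qed

section \<open>Irreducibility of the affine line\<close>

lemma poly_functions_line:
  "p \<in> poly_functions {\<lambda>t. t} \<Longrightarrow> \<exists>P. \<forall>t. p t = poly P t"
proof (induction rule: poly_functions.induct)
  case (const c)
  then show ?case by (intro exI[of _ "[:c:]"]) simp
next
  case (coord f)
  then show ?case by (intro exI[of _ "[:0, 1:]"]) simp
next
  case (add f g)
  then show ?case by (metis poly_add)
next
  case (mult f g)
  then show ?case by (metis poly_mult)
qed

text \<open>
  A nonempty open set contains the non-zeros of a nonzero polynomial. The product of two such
  polynomials has only finitely many zeros, but there are infinitely many complex numbers.
\<close>

lemma open_sets_of_line_meet:
  assumes "openin (zariski (affine_variety UNIV {\<lambda>t. t})) A" and "s \<in> A"
    and "openin (zariski (affine_variety UNIV {\<lambda>t. t})) B" and "t \<in> B"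
  shows "\<exists>u. u \<in> A \<and> u \<in> B"
proof -
  obtain p where p: "p \<in> poly_functions {\<lambda>t. t}" "s \<in> principal_open UNIV p" "principal_open UNIV p \<subseteq> A"
    using principal_open_basis assms(1,2) by meson
  obtain q where q: "q \<in> poly_functions {\<lambda>t. t}" "t \<in> principal_open UNIV q" "principal_open UNIV q \<subseteq> B"
    using principal_open_basis assms(3,4) by meson
  obtain P Q where PQ: "\<forall>t. p t = poly P t" "\<forall>t. q t = poly Q t"
    using poly_functions_line p q by meson
  have "P * Q \<noteq> 0" using PQ p q by (auto simp: principal_open_def)
  then have "finite {u. poly (P * Q) u = 0}" by (rule poly_roots_finite)
  then obtain u where "poly (P * Q) u \<noteq> 0"
    by (metis (mono_tags, lifting) infinite_UNIV_char_0 ex_new_if_finite mem_Collect_eq)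
  then show ?thesis using PQ p q by (intro exI[of _ u]) (auto simp: principal_open_def)
qed

section \<open>Spans of the first columns\<close>

lemma index_mult_mat_sum:
  assumes "A \<in> carrier_mat n m" and "B \<in> carrier_mat m l" and "r < n" and "c < l"
  shows "(A * B) $$ (r, c) = (\<Sum>a<m. A $$ (r, a) * B $$ (a, c))"
  using assms by (auto simp: scalar_prod_def lessThan_atLeast0 intro!: sum.cong)

lemma mem_first_cols_span_iff:
  assumes g: "g \<in> carrier_mat n n" and k: "k \<le> n"
  shows "v \<in> first_cols_span k n g \<longleftrightarrow>
    v \<in> carrier_vec n \<and> (\<exists>x. \<forall>r<n. v $ r = (\<Sum>a<k. g $$ (r, a) * x a))"
proof -
  interpret vec_space "TYPE(complex)" n .
  let ?A = "mat_of_cols n (take k (cols g))"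
  have A: "?A \<in> carrier_mat n k" using g k by auto
  have sub: "set (take k (cols g)) \<subseteq> carrier_vec n"
    using set_take_subset[of k "cols g"] cols_dim[of g] g by auto
  have "first_cols_span k n g = col_space ?A"
    unfolding first_cols_span_def col_space_def by (simp only: cols_mat_of_cols[OF sub])
  then have "v \<in> first_cols_span k n g \<longleftrightarrow>
      v \<in> carrier_vec n \<and> (\<exists>x\<in>carrier_vec k. ?A *\<^sub>v x = v)"
    unfolding col_space_eq[OF A] carrier_matD[OF A] by blast
  moreover have ix: "(?A *\<^sub>v x) $ r = (\<Sum>a<k. g $$ (r, a) * x $ a)"
    if "x \<in> carrier_vec k" "r < n" for x r
    using that A g k
    by (auto simp: scalar_prod_def lessThan_atLeast0 mat_of_cols_index intro!: sum.cong)
  moreover have "(\<exists>x\<in>carrier_vec k. ?A *\<^sub>v x = v) \<longleftrightarrow>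
      (\<exists>x. \<forall>r<n. v $ r = (\<Sum>a<k. g $$ (r, a) * x a))" if v: "v \<in> carrier_vec n"
  proof
    assume "\<exists>x\<in>carrier_vec k. ?A *\<^sub>v x = v"
    then obtain x where "x \<in> carrier_vec k" "?A *\<^sub>v x = v" by blast
    then show "\<exists>x. \<forall>r<n. v $ r = (\<Sum>a<k. g $$ (r, a) * x a)"
      using ix by (intro exI[of _ "\<lambda>a. x $ a"]) auto
  next
    assume "\<exists>x. \<forall>r<n. v $ r = (\<Sum>a<k. g $$ (r, a) * x a)"
    then obtain x where x: "\<forall>r<n. v $ r = (\<Sum>a<k. g $$ (r, a) * x a)" by blast
    have "?A *\<^sub>v vec k x = v"
      using v A x by (intro eq_vecI) (auto simp: ix simp del: index_mult_mat_vec)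
    then show "\<exists>x\<in>carrier_vec k. ?A *\<^sub>v x = v" by (intro bexI[of _ "vec k x"]) auto
  qed
  ultimately show ?thesis by auto
qed

text \<open>
  The inclusion of spans says that \<open>A = B * T\<close> on the first \<open>k\<close> columns. In this form it can be
  restricted to some of the rows, which is how subspaces of different ambient dimension are
  compared.
\<close>

lemma first_cols_span_subset_iff:
  assumes A: "A \<in> carrier_mat n n" and B: "B \<in> carrier_mat n n" and k: "k \<le> n"
  shows "first_cols_span k n A \<subseteq> first_cols_span k n B \<longleftrightarrow>
    (\<exists>T. \<forall>r<n. \<forall>c<k. A $$ (r, c) = (\<Sum>a<k. B $$ (r, a) * T a c))"
proof
  assume sub: "first_cols_span k n A \<subseteq> first_cols_span k n B"
  have "\<exists>x. \<forall>r<n. A $$ (r, c) = (\<Sum>a<k. B $$ (r, a) * x a)" if c: "c < k" for c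
  proof -
    have "col A c \<in> first_cols_span k n A"
      unfolding mem_first_cols_span_iff[OF A k]
      using A c k by (auto intro!: exI[of _ "\<lambda>a. if a = c then 1 else 0"] simp: if_distrib cong: if_cong)
    then have "col A c \<in> first_cols_span k n B" using sub by blast
    then show ?thesis unfolding mem_first_cols_span_iff[OF B k] using A c k by auto
  qed
  then obtain T where "\<And>c. c < k \<Longrightarrow> \<forall>r<n. A $$ (r, c) = (\<Sum>a<k. B $$ (r, a) * T c a)" by metis
  then show "\<exists>T. \<forall>r<n. \<forall>c<k. A $$ (r, c) = (\<Sum>a<k. B $$ (r, a) * T a c)"
    by (intro exI[of _ "\<lambda>a c. T c a"]) auto
next
  assume "\<exists>T. \<forall>r<n. \<forall>c<k. A $$ (r, c) = (\<Sum>a<k. B $$ (r, a) * T a c)"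
  then obtain T where "\<forall>r<n. \<forall>c<k. A $$ (r, c) = (\<Sum>a<k. B $$ (r, a) * T a c)" ..
  then have T: "\<And>r c. r < n \<Longrightarrow> c < k \<Longrightarrow> A $$ (r, c) = (\<Sum>a<k. B $$ (r, a) * T a c)" by simp
  show "first_cols_span k n A \<subseteq> first_cols_span k n B"
  proof
    fix v assume "v \<in> first_cols_span k n A"
    then obtain x where v: "v \<in> carrier_vec n" and "\<forall>r<n. v $ r = (\<Sum>c<k. A $$ (r, c) * x c)"
      unfolding mem_first_cols_span_iff[OF A k] by blast
    then have x: "\<And>r. r < n \<Longrightarrow> v $ r = (\<Sum>c<k. A $$ (r, c) * x c)" by simp
    have "v $ r = (\<Sum>a<k. B $$ (r, a) * (\<Sum>c<k. T a c * x c))" if "r < n" for r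
    proof -
      have "v $ r = (\<Sum>c<k. \<Sum>a<k. B $$ (r, a) * T a c * x c)"
        using x[OF that] T[OF that] by (simp add: sum_distrib_right)
      also have "\<dots> = (\<Sum>a<k. \<Sum>c<k. B $$ (r, a) * T a c * x c)" by (rule sum.swap)
      finally show ?thesis by (simp add: sum_distrib_left mult.assoc)
    qed
    then show "v \<in> first_cols_span k n B"
      unfolding mem_first_cols_span_iff[OF B k] using v
      by (intro conjI exI[of _ "\<lambda>a. \<Sum>c<k. T a c * x c"]) auto
  qed
qed

lemma first_cols_span_cong:
  assumes "A \<in> carrier_mat n n" "B \<in> carrier_mat n n" "k \<le> n"
    and "\<And>r c. r < n \<Longrightarrow> c < k \<Longrightarrow> A $$ (r, c) = B $$ (r, c)"
  shows "first_cols_span k n A = first_cols_span k n B"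
  using assms(4) by (auto simp: mem_first_cols_span_iff[OF assms(1,3)] mem_first_cols_span_iff[OF assms(2,3)])

section \<open>A Pluecker coordinate as the determinant of a completed matrix\<close>

text \<open>
  The list \<open>L\<close> is meant to be a permutation of the row indices. Then, up to sign, the determinant of
  the completion is the minor of the first \<open>k\<close> columns of \<open>A\<close> in the rows \<open>L ! 0, \<dots>, L ! (k - 1)\<close>, a
  Pluecker coordinate of their span. Completing to a square matrix replaces minors by
  determinants and makes Cramer's rule applicable. The matrix \<open>A\<close> may have more than \<open>n\<close> rows, the
  others being ignored.
\<close>

definition completion :: "nat \<Rightarrow> nat \<Rightarrow> nat list \<Rightarrow> complex mat \<Rightarrow> complex mat" where
  "completion n k L A = mat n n (\<lambda>(r, c). if c < k then A $$ (r, c) else if r = L ! c then 1 else 0)"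

lemma completion_carrier [simp]: "completion n k L A \<in> carrier_mat n n"
  by (simp add: completion_def)

lemma completion_dim [simp]: "dim_row (completion n k L A) = n" "dim_col (completion n k L A) = n"
  by (simp_all add: completion_def)

lemma index_completion [simp]:
  "r < n \<Longrightarrow> c < n \<Longrightarrow>
    completion n k L A $$ (r, c) = (if c < k then A $$ (r, c) else if r = L ! c then 1 else 0)"
  by (simp add: completion_def)

lemma completion_cong:
  assumes "\<And>r c. r < n \<Longrightarrow> c < k \<Longrightarrow> A $$ (r, c) = B $$ (r, c)"
  shows "completion n k L A = completion n k L B"
  using assms by (intro eq_matI) auto

text \<open>
  If \<open>A = B * T\<close> on the first \<open>k\<close> columns, then the completion of \<open>A\<close> is the completion of \<open>B\<close>
  times the block diagonal matrix with blocks \<open>T\<close> and \<open>1\<close>, since both are completed by the same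
  columns. Thus the nonvanishing of the determinant depends only on the span.
\<close>

lemma det_completion_transfer:
  assumes k: "k \<le> n"
    and T: "\<And>r c. r < n \<Longrightarrow> c < k \<Longrightarrow> A $$ (r, c) = (\<Sum>a<k. B $$ (r, a) * T a c)"
    and nz: "det (completion n k L A) \<noteq> 0"
  shows "det (completion n k L B) \<noteq> 0"
proof -
  define D where "D = mat n n (\<lambda>(a, c). if c < k then if a < k then T a c else 0 else if a = c then 1 else 0)"
  have D: "D \<in> carrier_mat n n" by (simp add: D_def)
  have "completion n k L A = completion n k L B * D"
  proof (rule eq_matI)
    fix r c assume "r < dim_row (completion n k L B * D)" "c < dim_col (completion n k L B * D)"
    then have rc: "r < n" "c < n" using D by auto
    have "(completion n k L B * D) $$ (r, c) = (\<Sum>a<n. completion n k L B $$ (r, a) * D $$ (a, c))"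
      by (rule index_mult_mat_sum[OF _ D rc]) simp
    also have "\<dots> = completion n k L A $$ (r, c)"
    proof (cases "c < k")
      case True
      have "(\<Sum>a<n. completion n k L B $$ (r, a) * D $$ (a, c)) =
            (\<Sum>a<k. completion n k L B $$ (r, a) * D $$ (a, c))"
        using k rc True by (intro sum.mono_neutral_right) (auto simp: D_def)
      also have "\<dots> = (\<Sum>a<k. B $$ (r, a) * T a c)"
        using k rc True by (intro sum.cong) (auto simp: D_def)
      finally show ?thesis using T rc True by simp
    next
      case False
      have "(\<Sum>a<n. completion n k L B $$ (r, a) * D $$ (a, c)) =
            (\<Sum>a<n. if a = c then completion n k L B $$ (r, c) else 0)"
        using False rc by (intro sum.cong) (auto simp: D_def)
      then show ?thesis using False rc by simp
    qed
    finally show "completion n k L A $$ (r, c) = (completion n k L B * D) $$ (r, c)" by simp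
  qed (use D in auto)
  then have "det (completion n k L A) = det (completion n k L B) * det D"
    using det_mult[OF _ D] by simp
  then show ?thesis using nz by auto
qed

lemma det_completion_span:
  assumes A: "A \<in> carrier_mat n n" and B: "B \<in> carrier_mat n n" and k: "k \<le> n"
    and "first_cols_span k n A \<subseteq> first_cols_span k n B" and "det (completion n k L A) \<noteq> 0"
  shows "det (completion n k L B) \<noteq> 0"
proof -
  obtain T where "\<forall>r<n. \<forall>c<k. A $$ (r, c) = (\<Sum>a<k. B $$ (r, a) * T a c)"
    using assms(4) unfolding first_cols_span_subset_iff[OF A B k] ..
  then show ?thesis by (intro det_completion_transfer[OF k _ assms(5)]) auto
qed

lemma regular_det_completion:
  assumes U: "openin (zariski (affine_variety X C)) U"
    and reg: "\<And>r c. r < n \<Longrightarrow> c < k \<Longrightarrow> regular (affine_variety X C) U (\<lambda>x. G x $$ (r, c))"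
  shows "regular (affine_variety X C) U (\<lambda>x. det (completion n k L (G x)))"
proof (rule regular_det[OF U, where m = n])
  fix r c assume "r < n" "c < n"
  then show "regular (affine_variety X C) U (\<lambda>x. completion n k L (G x) $$ (r, c))"
    by (cases "c < k") (auto intro: reg regular_const U)
qed simp

section \<open>Subspaces as graphs over their projection\<close>

text \<open>
  The Grassmannian is a quotient of \<open>SL n\<close>, so an invertible matrix has to be normalised before it
  represents a point. Scaling the last column leaves the first \<open>k < n\<close> columns unchanged.
\<close>

definition rescale_last_col :: "complex mat \<Rightarrow> complex mat" where
  "rescale_last_col A = multcol (dim_col A - 1) (inverse (det A)) A"

lemma rescale_last_col_carrier [simp]: "A \<in> carrier_mat n n \<Longrightarrow> rescale_last_col A \<in> carrier_mat n n"
  by (auto simp: rescale_last_col_def mat_multcol_def)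

lemma index_rescale_last_col:
  "A \<in> carrier_mat n n \<Longrightarrow> r < n \<Longrightarrow> c < n \<Longrightarrow>
    rescale_last_col A $$ (r, c) = (if c = n - 1 then inverse (det A) * A $$ (r, c) else A $$ (r, c))"
  by (auto simp: rescale_last_col_def)

lemma rescale_last_col_in_SL:
  assumes A: "A \<in> carrier_mat n n" and "0 < n" and "det A \<noteq> 0"
  shows "rescale_last_col A \<in> SL n"
proof -
  have "det (rescale_last_col A) = det A * det (multrow_mat n (n - 1) (inverse (det A)))"
    using A unfolding rescale_last_col_def
    by (subst multcol_mat[OF A]) (auto intro!: det_mult)
  also have "\<dots> = 1" using assms by (subst det_multrow_mat) auto
  finally show ?thesis using A by (simp add: SL_def)
qed

text \<open>
  For \<open>g \<in> SL (n + 1)\<close> with invertible completion, \<open>chart_lift n k L g\<close> represents in \<open>SL n\<close> the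
  projection to the first \<open>n\<close> coordinates of the subspace represented by \<open>g\<close>; its entries are rational
  functions of those of \<open>g\<close>.
\<close>

definition chart_lift :: "nat \<Rightarrow> nat \<Rightarrow> nat list \<Rightarrow> complex mat \<Rightarrow> complex mat" where
  "chart_lift n k L g = rescale_last_col (completion n k L g)"

lemma chart_lift_carrier [simp]: "chart_lift n k L g \<in> carrier_mat n n"
  by (simp add: chart_lift_def)

lemma index_chart_lift:
  assumes "k < n" "r < n" "c < k"
  shows "chart_lift n k L g $$ (r, c) = g $$ (r, c)"
  using assms by (simp add: chart_lift_def index_rescale_last_col[of _ n])

lemma chart_lift_in_SL:
  assumes "k < n" and "det (completion n k L g) \<noteq> 0"
  shows "chart_lift n k L g \<in> SL n"
  using assms rescale_last_col_in_SL[of "completion n k L g" n] by (simp add: chart_lift_def)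

lemma regular_chart_lift:
  assumes U: "openin (zariski (affine_variety X C)) U"
    and reg: "\<And>r c. r < n \<Longrightarrow> c < k \<Longrightarrow> regular (affine_variety X C) U (\<lambda>x. G x $$ (r, c))"
    and nz: "\<And>x. x \<in> U \<Longrightarrow> det (completion n k L (G x)) \<noteq> 0"
    and rc: "r < n" "c < n"
  shows "regular (affine_variety X C) U (\<lambda>x. chart_lift n k L (G x) $$ (r, c))"
proof -
  have entry: "regular (affine_variety X C) U (\<lambda>x. completion n k L (G x) $$ (r, c))"
    using rc by (cases "c < k") (auto intro: reg regular_const U)
  have "regular (affine_variety X C) U (\<lambda>x. inverse (det (completion n k L (G x))))"
    by (intro regular_inverse regular_det_completion U reg nz)
  from regular_mult[OF this entry] entry show ?thesis
    using rc unfolding chart_lift_def by (cases "c = n - 1")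
      (simp_all add: index_rescale_last_col[of _ n] del: index_completion)
qed

text \<open>
  The row vector \<open>(g $$ (n, 0), \<dots>, g $$ (n, k - 1), 0, \<dots>, 0)\<close> times the inverse of the
  completion of \<open>g\<close>, if this exists, written with the adjugate so that its entries are visibly
  rational. They are
  the coefficients of the linear functional whose graph is the span of the first \<open>k\<close> columns of
  \<open>g\<close>, normalised to involve only the coordinates \<open>L ! 0, \<dots>, L ! (k - 1)\<close>.
\<close>

definition bottom_functional :: "nat \<Rightarrow> nat \<Rightarrow> nat list \<Rightarrow> complex mat \<Rightarrow> nat \<Rightarrow> complex" where
  "bottom_functional n k L g a =
    (\<Sum>c<k. g $$ (n, c) * adj_mat (completion n k L g) $$ (c, a)) / det (completion n k L g)"

lemma bottom_functional_times_completion: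
  assumes nz: "det (completion n k L g) \<noteq> 0" and k: "k \<le> n" and c: "c < n"
  shows "(\<Sum>a<n. bottom_functional n k L g a * completion n k L g $$ (a, c)) =
    (if c < k then g $$ (n, c) else 0)"
proof -
  let ?M = "completion n k L g"
  have M: "?M \<in> carrier_mat n n" by simp
  have adj: "(\<Sum>a<n. adj_mat ?M $$ (b, a) * ?M $$ (a, c)) = (if b = c then det ?M else 0)"
    if "b < n" for b
    using index_mult_mat_sum[OF adj_mat(1)[OF M] M that c] adj_mat(3)[OF M] that c by auto
  have "(\<Sum>a<n. bottom_functional n k L g a * ?M $$ (a, c)) =
      (\<Sum>a<n. \<Sum>b<k. g $$ (n, b) * (adj_mat ?M $$ (b, a) * ?M $$ (a, c))) / det ?M"
    unfolding bottom_functional_def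
    by (simp add: sum_divide_distrib sum_distrib_right mult.assoc)
  also have "\<dots> = (\<Sum>b<k. \<Sum>a<n. g $$ (n, b) * (adj_mat ?M $$ (b, a) * ?M $$ (a, c))) / det ?M"
    by (subst sum.swap) simp
  also have "\<dots> = (\<Sum>b<k. g $$ (n, b) * (if b = c then det ?M else 0)) / det ?M"
    using k by (simp add: sum_distrib_left[symmetric] adj)
  also have "\<dots> = (if c < k then g $$ (n, c) else 0)"
    using nz by (auto simp: if_distrib cong: if_cong)
  finally show ?thesis .
qed

lemma bottom_functional_row:
  assumes "det (completion n k L g) \<noteq> 0" and "k \<le> n" and "c < k"
  shows "(\<Sum>a<n. bottom_functional n k L g a * g $$ (a, c)) = g $$ (n, c)"
  using bottom_functional_times_completion[OF assms(1,2), of c] assms(2,3) by simp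

text \<open>
  The completing columns are unit vectors on which the functional is required to vanish.
\<close>

lemma bottom_functional_zero:
  assumes nz: "det (completion n k L g) \<noteq> 0" and "k \<le> c" "c < n" "L ! c < n"
  shows "bottom_functional n k L g (L ! c) = 0"
proof -
  have "(\<Sum>a<n. bottom_functional n k L g a * completion n k L g $$ (a, c)) =
      (\<Sum>a<n. if a = L ! c then bottom_functional n k L g (L ! c) else 0)"
    using assms by (intro sum.cong) auto
  then show ?thesis
    using bottom_functional_times_completion[OF nz, of c] assms by simp
qed

lemma bottom_functional_unique:
  assumes nz: "det (completion n k L g) \<noteq> 0" and k: "k \<le> n"
    and s: "\<And>c. c < n \<Longrightarrow> (\<Sum>a<n. s a * completion n k L g $$ (a, c)) = (if c < k then g $$ (n, c) else 0)"
    and a: "a < n"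
  shows "s a = bottom_functional n k L g a"
proof -
  let ?M = "completion n k L g"
  have M: "?M \<in> carrier_mat n n" by simp
  have adj: "(\<Sum>c<n. ?M $$ (b, c) * adj_mat ?M $$ (c, a)) = (if b = a then det ?M else 0)"
    if "b < n" for b
    using index_mult_mat_sum[OF M adj_mat(1)[OF M] that a] adj_mat(2)[OF M] that a by auto
  have "s a * det ?M = (\<Sum>b<n. s b * (if b = a then det ?M else 0))"
    using a by (simp add: if_distrib cong: if_cong)
  also have "\<dots> = (\<Sum>b<n. \<Sum>c<n. s b * (?M $$ (b, c) * adj_mat ?M $$ (c, a)))"
    by (intro sum.cong refl) (simp only: sum_distrib_left[symmetric] adj lessThan_iff)
  also have "\<dots> = (\<Sum>c<n. \<Sum>b<n. s b * (?M $$ (b, c) * adj_mat ?M $$ (c, a)))" by (rule sum.swap)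
  also have "\<dots> = (\<Sum>c<n. (if c < k then g $$ (n, c) else 0) * adj_mat ?M $$ (c, a))"
    by (intro sum.cong refl) (simp only: mult.assoc[symmetric] sum_distrib_right[symmetric] s lessThan_iff)
  also have "\<dots> = (\<Sum>c<k. g $$ (n, c) * adj_mat ?M $$ (c, a))"
    using k by (intro sum.mono_neutral_cong_right) auto
  finally show ?thesis using nz by (simp add: bottom_functional_def field_simps)
qed

text \<open>
  This recovers the parameters of the new root subgroups: they are the coefficients with which the
  bottom row is written as a combination of the rows \<open>L ! 0, \<dots>, L ! (k - 1)\<close>.
\<close>

lemma bottom_functional_eq_coefficients:
  assumes nz: "det (completion n k L g) \<noteq> 0" and k: "k \<le> n"
    and L: "distinct L" "set L = {..<n}"
    and row: "\<And>c. c < k \<Longrightarrow> g $$ (n, c) = (\<Sum>l<k. w l * g $$ (L ! l, c))"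
    and l: "l < k"
  shows "bottom_functional n k L g (L ! l) = w l"
proof -
  have len: "length L = n" using distinct_card[OF L(1)] L(2) by simp
  have Ln: "L ! c < n" if "c < n" for c using that L(2) len nth_mem by fastforce
  \<comment> \<open>the functional with coefficient \<open>w m\<close> at the coordinate \<open>L ! m\<close> and zero elsewhere\<close>
  define s where "s a = (\<Sum>m<k. if a = L ! m then w m else 0)" for a
  have "(\<Sum>a<n. s a * completion n k L g $$ (a, c)) = (if c < k then g $$ (n, c) else 0)"
    if c: "c < n" for c
  proof -
    have "(\<Sum>a<n. s a * completion n k L g $$ (a, c)) =
        (\<Sum>m<k. \<Sum>a<n. (if a = L ! m then w m else 0) * completion n k L g $$ (a, c))"
      unfolding s_def sum_distrib_right by (rule sum.swap)
    also have "\<dots> = (\<Sum>m<k. w m * completion n k L g $$ (L ! m, c))"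
    proof (intro sum.cong refl)
      fix m assume m: "m \<in> {..<k}"
      have "(\<Sum>a<n. (if a = L ! m then w m else 0) * completion n k L g $$ (a, c)) =
          (\<Sum>a<n. if a = L ! m then w m * completion n k L g $$ (L ! m, c) else 0)"
        by (intro sum.cong) auto
      then show "(\<Sum>a<n. (if a = L ! m then w m else 0) * completion n k L g $$ (a, c)) =
          w m * completion n k L g $$ (L ! m, c)"
        using m k Ln[of m] by simp
    qed
    also have "\<dots> = (if c < k then g $$ (n, c) else 0)"
    proof (cases "c < k")
      case True
      then show ?thesis using row[OF True] c k Ln by (auto intro!: sum.cong)
    next
      case False
      have "w m * completion n k L g $$ (L ! m, c) = 0" if "m < k" for m
        using that False c k Ln[of m] L(1) len by (simp add: nth_eq_iff_index_eq)
      then have "(\<Sum>m<k. w m * completion n k L g $$ (L ! m, c)) = 0"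
        by (intro sum.neutral) blast
      then show ?thesis using False by simp
    qed
    finally show ?thesis .
  qed
  then have "s (L ! l) = bottom_functional n k L g (L ! l)"
    using l k by (intro bottom_functional_unique[OF nz k] Ln) auto
  moreover have "s (L ! l) = (\<Sum>m<k. if m = l then w m else 0)"
    unfolding s_def using l k len L(1) by (intro sum.cong) (auto simp: nth_eq_iff_index_eq)
  ultimately show ?thesis using l by simp
qed

lemma regular_bottom_functional:
  assumes U: "openin (zariski (affine_variety X C)) U" and k: "k < n"
    and reg: "\<And>r c. r < Suc n \<Longrightarrow> c < k \<Longrightarrow> regular (affine_variety X C) U (\<lambda>x. G x $$ (r, c))"
    and nz: "\<And>x. x \<in> U \<Longrightarrow> det (completion n k L (G x)) \<noteq> 0"
    and a: "a < n"
  shows "regular (affine_variety X C) U (\<lambda>x. bottom_functional n k L (G x) a)"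
proof -
  have entry: "regular (affine_variety X C) U (\<lambda>x. completion n k L (G x) $$ (r, c))" if "r < n" "c < n" for r c
    using that by (cases "c < k") (auto intro: reg regular_const U)
  have "regular (affine_variety X C) U (\<lambda>x. adj_mat (completion n k L (G x)) $$ (c, a))" if c: "c < n" for c
  proof -
    have "regular (affine_variety X C) U (\<lambda>x. det (mat_delete (completion n k L (G x)) a c))"
    proof (rule regular_det[OF U, where m = "n - 1"])
      fix r s assume "r < n - 1" "s < n - 1"
      then show "regular (affine_variety X C) U (\<lambda>x. mat_delete (completion n k L (G x)) a c $$ (r, s))"
        by (simp add: mat_delete_def del: index_completion) (auto intro!: entry simp del: index_completion)
    qed (intro mat_delete_carrier completion_carrier)
    then show ?thesis
      using a c unfolding adj_mat_def
      by (simp add: cofactor_def) (intro regular_mult regular_const U)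
  qed
  then show ?thesis
    unfolding bottom_functional_def using k
    by (intro regular_divide regular_sum regular_mult regular_det_completion U reg nz) auto
qed

text \<open>
  The projection of the subspace and the functional having it as graph are functions of the
  subspace alone, so they descend to the Grassmannian: if \<open>g' = g * T\<close> on the first \<open>k\<close> columns, all
  rows transform by the same \<open>T\<close>, and the equations characterising the functional are preserved.
\<close>

lemma chart_span_invariant:
  assumes g: "g \<in> carrier_mat (Suc n) (Suc n)" and g': "g' \<in> carrier_mat (Suc n) (Suc n)" and k: "k < n"
    and L: "\<And>c. c < n \<Longrightarrow> L ! c < n"
    and eq: "first_cols_span k (Suc n) g = first_cols_span k (Suc n) g'"
    and nz: "det (completion n k L g) \<noteq> 0"
  shows "det (completion n k L g') \<noteq> 0"
    and "first_cols_span k n (chart_lift n k L g) = first_cols_span k n (chart_lift n k L g')"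
    and "\<And>a. a < n \<Longrightarrow> bottom_functional n k L g a = bottom_functional n k L g' a"
proof -
  have kS: "k \<le> Suc n" "k \<le> n" using k by auto
  obtain T where T: "\<forall>r<Suc n. \<forall>c<k. g $$ (r, c) = (\<Sum>a<k. g' $$ (r, a) * T a c)"
    using eq first_cols_span_subset_iff[OF g g' kS(1)] by blast
  obtain T' where T': "\<forall>r<Suc n. \<forall>c<k. g' $$ (r, c) = (\<Sum>a<k. g $$ (r, a) * T' a c)"
    using eq first_cols_span_subset_iff[OF g' g kS(1)] by blast
  show nz': "det (completion n k L g') \<noteq> 0"
    using T by (intro det_completion_transfer[OF kS(2) _ nz]) auto
  show "first_cols_span k n (chart_lift n k L g) = first_cols_span k n (chart_lift n k L g')"
  proof
    have "\<forall>r<n. \<forall>c<k. chart_lift n k L g $$ (r, c) = (\<Sum>a<k. chart_lift n k L g' $$ (r, a) * T a c)"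
      using T k by (simp add: index_chart_lift)
    then show "first_cols_span k n (chart_lift n k L g) \<subseteq> first_cols_span k n (chart_lift n k L g')"
      using first_cols_span_subset_iff[OF chart_lift_carrier chart_lift_carrier kS(2)] by blast
    have "\<forall>r<n. \<forall>c<k. chart_lift n k L g' $$ (r, c) = (\<Sum>a<k. chart_lift n k L g $$ (r, a) * T' a c)"
      using T' k by (simp add: index_chart_lift)
    then show "first_cols_span k n (chart_lift n k L g') \<subseteq> first_cols_span k n (chart_lift n k L g)"
      using first_cols_span_subset_iff[OF chart_lift_carrier chart_lift_carrier kS(2)] by blast
  qed
  let ?r = "bottom_functional n k L g"
  show "?r a = bottom_functional n k L g' a" if a: "a < n" for a
  proof (rule bottom_functional_unique[OF nz' kS(2) _ a])
    fix c assume c: "c < n"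
    show "(\<Sum>a<n. ?r a * completion n k L g' $$ (a, c)) = (if c < k then g' $$ (n, c) else 0)"
    proof (cases "c < k")
      case True
      have "(\<Sum>a<n. ?r a * completion n k L g' $$ (a, c)) =
          (\<Sum>a<n. \<Sum>b<k. ?r a * g $$ (a, b) * T' b c)"
        using T' True c by (intro sum.cong refl) (simp add: sum_distrib_left mult.assoc)
      also have "\<dots> = (\<Sum>b<k. (\<Sum>a<n. ?r a * g $$ (a, b)) * T' b c)"
        by (subst sum.swap) (simp add: sum_distrib_right)
      also have "\<dots> = g' $$ (n, c)"
        using T' True by (simp add: bottom_functional_row[OF nz kS(2)])
      finally show ?thesis using True by simp
    next
      case False
      then show ?thesis
        using bottom_functional_times_completion[OF nz kS(2) c] c by simp
    qed
  qed
qed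

text \<open>
  Conversely, a graph is determined by its base and its functional: a relation \<open>g = g' * T\<close> in the
  first \<open>n\<close> rows extends to the bottom row, which in both matrices is obtained from the other rows by
  the same functional.
\<close>

lemma chart_span_determined:
  assumes g: "g \<in> carrier_mat (Suc n) (Suc n)" and g': "g' \<in> carrier_mat (Suc n) (Suc n)" and k: "k < n"
    and nz: "det (completion n k L g) \<noteq> 0" and nz': "det (completion n k L g') \<noteq> 0"
    and eq: "first_cols_span k n (chart_lift n k L g) \<subseteq> first_cols_span k n (chart_lift n k L g')"
    and bf: "\<And>a. a < n \<Longrightarrow> bottom_functional n k L g a = bottom_functional n k L g' a"
  shows "first_cols_span k (Suc n) g \<subseteq> first_cols_span k (Suc n) g'"
proof -
  have kS: "k \<le> Suc n" "k \<le> n" using k by auto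
  obtain T where "\<forall>r<n. \<forall>c<k. chart_lift n k L g $$ (r, c) = (\<Sum>a<k. chart_lift n k L g' $$ (r, a) * T a c)"
    using eq unfolding first_cols_span_subset_iff[OF chart_lift_carrier chart_lift_carrier kS(2)] ..
  then have T: "\<And>r c. r < n \<Longrightarrow> c < k \<Longrightarrow> g $$ (r, c) = (\<Sum>a<k. g' $$ (r, a) * T a c)"
    using k by (simp add: index_chart_lift)
  have "g $$ (n, c) = (\<Sum>b<k. g' $$ (n, b) * T b c)" if c: "c < k" for c
  proof -
    have "g $$ (n, c) = (\<Sum>a<n. \<Sum>b<k. bottom_functional n k L g' a * g' $$ (a, b) * T b c)"
      unfolding bottom_functional_row[OF nz kS(2) c, symmetric]
      using T c bf by (intro sum.cong refl) (simp add: sum_distrib_left mult.assoc)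
    also have "\<dots> = (\<Sum>b<k. (\<Sum>a<n. bottom_functional n k L g' a * g' $$ (a, b)) * T b c)"
      by (subst sum.swap) (simp add: sum_distrib_right)
    finally show ?thesis by (simp add: bottom_functional_row[OF nz' kS(2)])
  qed
  then have "\<forall>r<Suc n. \<forall>c<k. g $$ (r, c) = (\<Sum>a<k. g' $$ (r, a) * T a c)"
    using T by (auto simp: less_Suc_eq)
  then show ?thesis unfolding first_cols_span_subset_iff[OF g g' kS(1)] by - (rule exI[of _ T])
qed

section \<open>The Grassmannian as a quotient of the special linear group\<close>

text \<open>
  Pulled back to \<open>SL n\<close>, an affine variety, questions about open sets and regular functions on the
  Grassmannian become questions about rational functions of matrix entries.
\<close>

lemma openin_Grassmannian_iff:
  "openin (zariski (Grassmannian k n)) V \<longleftrightarrow> V \<subseteq> subspaces_of_dim k n \<and>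
     openin (zariski (SL_variety n)) {g \<in> SL n. first_cols_span k n g \<in> V}"
  using topology_inverse'[OF istopology_quotient[of "subspaces_of_dim k n"
      "zariski (SL_variety n)" "first_cols_span k n"]]
  by (simp add: Grassmannian_def quotient_variety_def topspace_SL)

lemma regular_Grassmannian_iff:
  "regular (Grassmannian k n) V f \<longleftrightarrow>
    regular (SL_variety n) {g \<in> SL n. first_cols_span k n g \<in> V} (\<lambda>g. f (first_cols_span k n g))"
  by (simp add: Grassmannian_def quotient_variety_def topspace_SL o_def)

lemma regular_SL_entry:
  "openin (zariski (SL_variety n)) U \<Longrightarrow> r < n \<Longrightarrow> c < n \<Longrightarrow> regular (SL_variety n) U (\<lambda>g. g $$ (r, c))"
  unfolding SL_variety_def by (rule regular_coord) auto

lemma morphism_to_Grassmannian: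
  assumes U: "openin (zariski (affine_variety X C)) U" and k: "k \<le> n"
    and G: "\<And>x. x \<in> U \<Longrightarrow> G x \<in> SL n"
    and reg: "\<And>r c. r < n \<Longrightarrow> c < n \<Longrightarrow> regular (affine_variety X C) U (\<lambda>x. G x $$ (r, c))"
    and V: "\<And>x. x \<in> U \<Longrightarrow> first_cols_span k n (G x) \<in> V" "V \<subseteq> subspaces_of_dim k n"
  shows "morphism_on (affine_variety X C) U (Grassmannian k n) V (\<lambda>x. first_cols_span k n (G x))"
proof (rule morphism_onI[OF U V(1)])
  have coords: "regular (affine_variety X C) U (\<lambda>x. c (G x))"
    if "c \<in> {(\<lambda>g. g $$ (r, c)) | r c. r < n \<and> c < n}" for c
    using that reg by auto
  have eq: "{x \<in> U. first_cols_span k n (G x) \<in> W} = {x \<in> U. G x \<in> {g \<in> SL n. first_cols_span k n g \<in> W}}" for W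
    using G by auto
  show "V \<subseteq> topspace (zariski (Grassmannian k n))" using V k by (simp add: topspace_Grassmannian)
  fix W
  show "openin (zariski (affine_variety X C)) {x \<in> U. first_cols_span k n (G x) \<in> W}"
    if "openin (zariski (Grassmannian k n)) W"
    unfolding eq using that
    unfolding openin_Grassmannian_iff SL_variety_def
    by (elim conjE) (rule openin_regular_preimage[where F = G, OF U G coords])
  show "regular (affine_variety X C) {x \<in> U. first_cols_span k n (G x) \<in> W} (\<lambda>x. f (first_cols_span k n (G x)))"
    if "regular (Grassmannian k n) W f" for f
    unfolding eq using that
    by (intro regular_pullback[where F = G and f = "\<lambda>g. f (first_cols_span k n g)", OF U G coords])
       (auto simp: regular_Grassmannian_iff SL_variety_def)
qed

lemma morphism_from_Grassmannian:
  assumes V: "openin (zariski (Grassmannian k n)) V" and k: "k \<le> n"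
    and \<psi>: "\<And>W. W \<in> V \<Longrightarrow> \<psi> W \<in> U" "U \<subseteq> Y"
    and reg: "\<And>c. c \<in> D \<Longrightarrow>
      regular (SL_variety n) {g \<in> SL n. first_cols_span k n g \<in> V} (\<lambda>g. c (\<psi> (first_cols_span k n g)))"
  shows "morphism_on (Grassmannian k n) V (affine_variety Y D) U \<psi>"
proof (rule morphism_onI[OF V \<psi>(1)])
  let ?O = "{g \<in> SL n. first_cols_span k n g \<in> V}"
  have O: "openin (zariski (SL_variety n)) ?O" using V by (simp add: openin_Grassmannian_iff)
  have Y: "\<psi> (first_cols_span k n g) \<in> Y" if "g \<in> ?O" for g using that \<psi> by auto
  have eq: "{g \<in> SL n. first_cols_span k n g \<in> {W \<in> V. \<psi> W \<in> N}} =
      {g \<in> ?O. \<psi> (first_cols_span k n g) \<in> N}" for N by auto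
  show "U \<subseteq> topspace (zariski (affine_variety Y D))" using \<psi> by (simp add: topspace_affine)
  fix N
  show "openin (zariski (Grassmannian k n)) {W \<in> V. \<psi> W \<in> N}"
    if "openin (zariski (affine_variety Y D)) N"
    unfolding openin_Grassmannian_iff eq
    using V openin_regular_preimage[where F = "\<lambda>g. \<psi> (first_cols_span k n g)",
      OF O[unfolded SL_variety_def] Y reg[unfolded SL_variety_def] that]
    by (auto simp: openin_Grassmannian_iff SL_variety_def)
  show "regular (Grassmannian k n) {W \<in> V. \<psi> W \<in> N} (\<lambda>x. f (\<psi> x))"
    if "regular (affine_variety Y D) N f" for f
    unfolding regular_Grassmannian_iff eq
    using regular_pullback[where F = "\<lambda>g. \<psi> (first_cols_span k n g)",
      OF O[unfolded SL_variety_def] Y reg[unfolded SL_variety_def] that]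
    by (simp add: SL_variety_def)
qed

section \<open>Density of the locus where a Pluecker coordinate does not vanish\<close>

text \<open>
  Without any column taken from \<open>A\<close>, the completion is the matrix of a permutation.
\<close>

lemma det_completion_permutation:
  assumes L: "distinct L" "set L = {..<n}"
  shows "det (completion n 0 L A) \<noteq> 0"
proof -
  let ?P = "completion n 0 L A"
  have len: "length L = n" using distinct_card[OF L(1)] L(2) by simp
  have P: "?P \<in> carrier_mat n n" "transpose_mat ?P \<in> carrier_mat n n" by auto
  have "transpose_mat ?P * ?P = 1\<^sub>m n"
  proof (rule eq_matI)
    fix a b assume "a < dim_row (1\<^sub>m n)" "b < dim_col (1\<^sub>m n)"
    then have ab: "a < n" "b < n" by auto
    have La: "L ! a < n" using ab L(2) len nth_mem by fastforce
    have "(transpose_mat ?P * ?P) $$ (a, b) = (\<Sum>r<n. transpose_mat ?P $$ (a, r) * ?P $$ (r, b))"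
      by (rule index_mult_mat_sum[OF P(2,1) ab])
    also have "\<dots> = (\<Sum>r<n. if r = L ! a then if L ! a = L ! b then 1 else 0 else 0)"
      using ab by (intro sum.cong) auto
    also have "\<dots> = (if a = b then 1 else 0)"
      using ab La len L(1) by (auto simp: nth_eq_iff_index_eq)
    finally show "(transpose_mat ?P * ?P) $$ (a, b) = 1\<^sub>m n $$ (a, b)" using ab by simp
  qed auto
  then have "det (transpose_mat ?P) * det ?P = 1"
    using det_mult[OF P(2,1)] by simp
  then show ?thesis by auto
qed

text \<open>
  Joining \<open>g\<close> by a line to a matrix \<open>P\<close> with invertible completion reduces the density to the affine
  line: near the parameter \<open>0\<close> the point on the line is invertible and, rescaled to
  determinant \<open>1\<close>, still lies in \<open>N\<close>; near the parameter \<open>1\<close> its completion is invertible; and two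
  nonempty open subsets of the line meet.
\<close>

lemma chart_dense:
  assumes N: "openin (zariski (SL_variety n)) N" and g: "g \<in> N" and k: "k < n"
    and L: "distinct L" "set L = {..<n}"
  shows "\<exists>g'\<in>N. det (completion n k L g') \<noteq> 0"
proof -
  let ?line = "affine_variety (UNIV :: complex set) {\<lambda>t. t}"
  \<comment> \<open>a permutation matrix, hence its own completion\<close>
  define P where "P = completion n 0 L g"
  define B where "B t = mat n n (\<lambda>(r, c). (1 - t) * g $$ (r, c) + t * P $$ (r, c))" for t
  have line: "openin (zariski ?line) UNIV" using openin_affine_topspace .
  have gSL: "g \<in> SL n" using open_subset_affine N g by (auto simp: SL_variety_def)
  then have gc: "g \<in> carrier_mat n n" "det g = 1" by (auto simp: SL_def)
  have Bc: "B t \<in> carrier_mat n n" for t by (simp add: B_def)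
  have B0: "B 0 = g" using gc by (intro eq_matI) (auto simp: B_def)
  have B1: "B 1 = P" by (intro eq_matI) (auto simp: B_def P_def)
  have regB: "regular ?line UNIV (\<lambda>t. B t $$ (r, c))" if "r < n" "c < n" for r c
  proof -
    have "regular ?line UNIV (\<lambda>t. (1 + (-1) * t) * g $$ (r, c) + t * P $$ (r, c))"
      by (intro regular_add regular_mult regular_const line) (auto intro!: regular_coord line)
    then show ?thesis using that by (simp add: B_def)
  qed
  define E where "E = {t. det (B t) \<noteq> 0}"
  have detB: "regular ?line UNIV (\<lambda>t. det (B t))" by (rule regular_det[OF line Bc regB])
  have E: "openin (zariski ?line) E"
    using openin_regular_nonzero[OF detB] by (simp add: E_def)
  have regBE: "regular ?line E (\<lambda>t. B t $$ (r, c))" if "r < n" "c < n" for r c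
    by (rule regular_subset[OF regB[OF that] E]) simp
  have regR: "regular ?line E (\<lambda>t. rescale_last_col (B t) $$ (r, c))" if rc: "r < n" "c < n" for r c
  proof (cases "c = n - 1")
    case True
    have "regular ?line E (\<lambda>t. inverse (det (B t)) * B t $$ (r, c))"
      using rc by (intro regular_mult regular_inverse regBE regular_subset[OF detB E]) (auto simp: E_def)
    then show ?thesis using rc True by (simp add: index_rescale_last_col[OF Bc])
  next
    case False
    then show ?thesis using rc regBE by (simp add: index_rescale_last_col[OF Bc])
  qed
  have RSL: "rescale_last_col (B t) \<in> SL n" if "t \<in> E" for t
    using that k by (intro rescale_last_col_in_SL[OF Bc]) (auto simp: E_def)
  have 1: "openin (zariski ?line) {t \<in> E. rescale_last_col (B t) \<in> N}"
    by (rule openin_regular_preimage[where F = "\<lambda>t. rescale_last_col (B t)",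
          OF E RSL _ N[unfolded SL_variety_def]]) (auto intro: regR)
  have "rescale_last_col (B 0) = g"
    unfolding B0 using gc k by (intro eq_matI) (auto simp: index_rescale_last_col rescale_last_col_def)
  then have 2: "0 \<in> {t \<in> E. rescale_last_col (B t) \<in> N}" using g gc by (simp add: E_def B0)
  have "regular ?line UNIV (\<lambda>t. det (completion n k L (B t)))"
    using k by (intro regular_det_completion line regB) auto
  from openin_regular_nonzero[OF this]
  have 3: "openin (zariski ?line) {t. det (completion n k L (B t)) \<noteq> 0}" by simp
  have "completion n k L P = P" using k by (intro eq_matI) (auto simp: P_def)
  then have 4: "1 \<in> {t. det (completion n k L (B t)) \<noteq> 0}"
    using det_completion_permutation[OF L] by (simp add: B1 P_def)
  obtain u where u: "u \<in> E" "rescale_last_col (B u) \<in> N" "det (completion n k L (B u)) \<noteq> 0"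
    using open_sets_of_line_meet[OF 1 2 3 4] by blast
  have "completion n k L (rescale_last_col (B u)) = completion n k L (B u)"
    using k by (intro completion_cong) (auto simp: index_rescale_last_col[OF Bc])
  then show ?thesis using u by (intro bexI[of _ "rescale_last_col (B u)"]) auto
qed

section \<open>Products of elements of root subgroups\<close>

text \<open>
  The same product as \<open>root_product\<close>, but recursive and with the parameters given by a function, so
  that parameters can be shifted without forming new vectors.
\<close>

primrec root_prod :: "nat \<Rightarrow> root list \<Rightarrow> (nat \<Rightarrow> complex) \<Rightarrow> complex mat" where
  "root_prod n [] \<zeta> = 1\<^sub>m n"
| "root_prod n (\<beta> # S) \<zeta> = exp_root n \<beta> (\<zeta> 0) * root_prod n S (\<lambda>l. \<zeta> (Suc l))"

lemma root_product_eq_root_prod: "root_product n S z = root_prod n S (\<lambda>l. z $ l)"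
proof -
  have "foldr (*) (map (\<lambda>l. exp_root n (S ! l) (\<zeta> l)) [0..<length S]) (1\<^sub>m n) = root_prod n S \<zeta>"
    for \<zeta> :: "nat \<Rightarrow> complex"
  proof (induction S arbitrary: \<zeta>)
    case (Cons \<beta> S)
    have "map (\<lambda>l. exp_root n ((\<beta> # S) ! l) (\<zeta> l)) [0..<length (\<beta> # S)] =
        exp_root n \<beta> (\<zeta> 0) # map (\<lambda>l. exp_root n (S ! l) (\<zeta> (Suc l))) [0..<length S]"
      by (simp only: length_Cons upt_conv_Cons[OF zero_less_Suc] map_Suc_upt[symmetric]) (simp add: o_def)
    then show ?case using Cons.IH[of "\<lambda>l. \<zeta> (Suc l)"] by (simp del: upt_Suc)
  qed simp
  then show ?thesis by (simp add: root_product_def)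
qed

lemma root_prod_cong:
  "(\<And>l. l < length S \<Longrightarrow> \<zeta> l = \<xi> l) \<Longrightarrow> root_prod n S \<zeta> = root_prod n S \<xi>"
proof (induction S arbitrary: \<zeta> \<xi>)
  case (Cons \<beta> S)
  have "root_prod n S (\<lambda>l. \<zeta> (Suc l)) = root_prod n S (\<lambda>l. \<xi> (Suc l))"
    by (rule Cons.IH) (simp add: Cons.prems)
  then show ?case by (simp add: Cons.prems)
qed simp

lemma exp_root_carrier [simp]: "exp_root n \<beta> t \<in> carrier_mat n n"
  by (cases \<beta>) (simp add: exp_root_def root_matrix_def)

lemma root_prod_carrier [simp]: "root_prod n S \<zeta> \<in> carrier_mat n n"
  by (induction S arbitrary: \<zeta>) (auto intro: mult_carrier_mat[OF exp_root_carrier])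

lemma exp_root_eq_addrow_mat:
  assumes "(i, j) \<in> positive_roots n"
  shows "exp_root n (i, j) t = addrow_mat n t (j - 1) (i - 1)"
  using assms by (intro eq_matI) (auto simp: exp_root_def root_matrix_def positive_roots_def)

lemma index_exp_root_mult:
  assumes "(i, j) \<in> positive_roots n" and A: "A \<in> carrier_mat n n" and "r < n" "c < n"
  shows "(exp_root n (i, j) t * A) $$ (r, c) =
    A $$ (r, c) + (if r = j - 1 then t * A $$ (i - 1, c) else 0)"
proof -
  have "i - 1 < n" using assms(1) by (auto simp: positive_roots_def)
  then have "exp_root n (i, j) t * A = addrow t (j - 1) (i - 1) A"
    by (simp add: exp_root_eq_addrow_mat[OF assms(1)] addrow_mat[OF A])
  then show ?thesis using assms by auto
qed

lemma root_prod_in_SL: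
  assumes "set S \<subseteq> positive_roots n"
  shows "root_prod n S \<zeta> \<in> SL n"
proof -
  have "det (root_prod n S \<zeta>) = 1" using assms
  proof (induction S arbitrary: \<zeta>)
    case (Cons \<beta> S)
    obtain i j where \<beta>: "\<beta> = (i, j)" by force
    then have "det (exp_root n \<beta> (\<zeta> 0)) = 1"
      using Cons.prems by (auto simp: exp_root_eq_addrow_mat positive_roots_def intro!: det_addrow_mat)
    then show ?case using Cons by (simp add: det_mult[of _ n])
  qed simp
  then show ?thesis by (simp add: SL_def)
qed

lemma regular_root_prod:
  assumes "set S \<subseteq> positive_roots n" and U: "openin (zariski (affine_variety X C)) U"
    and "\<And>l. l < length S \<Longrightarrow> regular (affine_variety X C) U (\<lambda>x. \<zeta> x l)"
    and "r < n" "c < n"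
  shows "regular (affine_variety X C) U (\<lambda>x. root_prod n S (\<zeta> x) $$ (r, c))"
  using assms(1,3-)
proof (induction S arbitrary: \<zeta> r)
  case Nil
  then show ?case using U by (auto intro: regular_const)
next
  case (Cons \<beta> S)
  obtain i j where \<beta>: "\<beta> = (i, j)" by force
  have ij: "(i, j) \<in> positive_roots n" "i - 1 < n" using Cons.prems \<beta> by (auto simp: positive_roots_def)
  have IH: "regular (affine_variety X C) U (\<lambda>x. root_prod n S (\<lambda>l. \<zeta> x (Suc l)) $$ (r, c))" if "r < n" for r
    using Cons.IH[of "\<lambda>x l. \<zeta> x (Suc l)"] Cons.prems that by simp
  have "regular (affine_variety X C) U (\<lambda>x. root_prod n S (\<lambda>l. \<zeta> x (Suc l)) $$ (r, c) +
      (if r = j - 1 then \<zeta> x 0 * root_prod n S (\<lambda>l. \<zeta> x (Suc l)) $$ (i - 1, c) else 0))"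
    using Cons.prems ij by (cases "r = j - 1") (auto intro!: regular_add regular_mult IH regular_const U)
  then show ?case
    using Cons.prems by (simp add: \<beta> index_exp_root_mult[OF ij(1)])
qed

text \<open>
  For roots not involving the last index, the product in dimension \<open>n + 1\<close> is block diagonal with the
  product in dimension \<open>n\<close> as first block.
\<close>

lemma root_prod_embed:
  assumes "set S \<subseteq> positive_roots n" and "r < Suc n" and "c < n"
  shows "root_prod (Suc n) S \<zeta> $$ (r, c) = (if r < n then root_prod n S \<zeta> $$ (r, c) else 0)"
  using assms(1,2)
proof (induction S arbitrary: \<zeta> r)
  case Nil
  then show ?case using assms(3) by auto
next
  case (Cons \<beta> S)
  obtain i j where \<beta>: "\<beta> = (i, j)" by force
  have ij: "(i, j) \<in> positive_roots n" "(i, j) \<in> positive_roots (Suc n)" "i - 1 < n" "j - 1 < n"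
    using Cons.prems \<beta> by (auto simp: positive_roots_def)
  show ?case
    using Cons.prems assms(3) ij(3,4) Cons.IH[of _ "\<lambda>l. \<zeta> (Suc l)"]
    by (simp add: \<beta> index_exp_root_mult[OF ij(1)] index_exp_root_mult[OF ij(2)])
qed

text \<open>
  The new factors add multiples of the rows \<open>i ! l - 1\<close> to the bottom row only, so they do not
  interfere with each other.
\<close>

lemma root_prod_prefix:
  assumes "set i \<subseteq> {1..n}" and "r < Suc n" and "c < Suc n"
  shows "root_prod (Suc n) (map (\<lambda>m. (m, Suc n)) i @ S) \<zeta> $$ (r, c) =
    (let A = root_prod (Suc n) S (\<lambda>l. \<zeta> (length i + l)) in
     A $$ (r, c) + (if r = n then \<Sum>l<length i. \<zeta> l * A $$ (i ! l - 1, c) else 0))"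
  using assms(1,2)
proof (induction i arbitrary: \<zeta> r)
  case (Cons m i)
  have m: "(m, Suc n) \<in> positive_roots (Suc n)" "m - 1 < n"
    using Cons.prems by (auto simp: positive_roots_def)
  show ?case
    using Cons.prems assms(3) m(2) Cons.IH[of _ "\<lambda>l. \<zeta> (Suc l)"]
    by (auto simp: index_exp_root_mult[OF m(1)] Let_def sum.lessThan_Suc_shift simp del: sum.lessThan_Suc)
qed (simp add: Let_def)

lemma root_prod_extended:
  assumes S: "set S \<subseteq> positive_roots n" and i: "set i \<subseteq> {1..n}" and c: "c < n"
  shows "r < n \<Longrightarrow> root_prod (Suc n) (map (\<lambda>m. (m, Suc n)) i @ S) \<zeta> $$ (r, c) =
      root_prod n S (\<lambda>l. \<zeta> (length i + l)) $$ (r, c)"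
    and "root_prod (Suc n) (map (\<lambda>m. (m, Suc n)) i @ S) \<zeta> $$ (n, c) =
      (\<Sum>l<length i. \<zeta> l * root_prod (Suc n) (map (\<lambda>m. (m, Suc n)) i @ S) \<zeta> $$ (i ! l - 1, c))"
proof -
  let ?A = "root_prod (Suc n) (map (\<lambda>m. (m, Suc n)) i @ S) \<zeta>"
  let ?B = "root_prod n S (\<lambda>l. \<zeta> (length i + l))"
  have top: "?A $$ (r, c) = ?B $$ (r, c)" if "r < n" for r
    using root_prod_prefix[OF i, of r c S \<zeta>] root_prod_embed[OF S, of r c] that c by (simp add: Let_def)
  then show "r < n \<Longrightarrow> ?A $$ (r, c) = ?B $$ (r, c)" .
  have row: "root_prod (Suc n) S (\<lambda>l. \<zeta> (length i + l)) $$ (i ! l - 1, c) = ?A $$ (i ! l - 1, c)"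
    if "l < length i" for l
  proof -
    have "i ! l - 1 < n" using i nth_mem[OF that] by fastforce
    then show ?thesis using root_prod_embed[OF S, of "i ! l - 1" c] c top by simp
  qed
  have "?A $$ (n, c) =
      (\<Sum>l<length i. \<zeta> l * root_prod (Suc n) S (\<lambda>l. \<zeta> (length i + l)) $$ (i ! l - 1, c))"
    using root_prod_prefix[OF i, of n c S \<zeta>] root_prod_embed[OF S, of n c] c by (simp add: Let_def)
  then show "?A $$ (n, c) = (\<Sum>l<length i. \<zeta> l * ?A $$ (i ! l - 1, c))"
    using row by simp
qed

section \<open>Extending a birational sequence\<close>

theorem lemma2:
  fixes k n :: nat and S :: "root list" and i :: "nat list"
  assumes "1 \<le> k" and "k < n"
    and "birational_sequence k n S"
    and "length i = k" and "distinct i" and "set i \<subseteq> {1..n}"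
  shows "birational_sequence k (n + 1) (map (\<lambda>m. (m, n + 1)) i @ S)"
proof -
  note k = \<open>k < n\<close>
  define d where "d = k * (n - k)"
  define D where "D = k * (Suc n - k)"
  have dD: "D = k + d" using k by (simp add: D_def d_def Suc_diff_le)
  define coords where "coords m = {(\<lambda>v :: complex vec. v $ l) | l. l < m}" for m :: nat
  have aff: "affine_space m = affine_variety (carrier_vec m) (coords m)" for m
    by (simp add: affine_space_def coords_def)
  define S' where "S' = map (\<lambda>m. (m, Suc n)) i @ S"
  define \<pi> where "\<pi> = first_cols_span k n"
  define \<pi>' where "\<pi>' = first_cols_span k (Suc n)"
  define \<phi> where "\<phi> = (\<lambda>v. \<pi> (root_prod n S (\<lambda>l. v $ l)))"

  from \<open>birational_sequence k n S\<close>
  have S: "set S \<subseteq> positive_roots n" "length S = d"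
    and bir: "birational_morphism (affine_space d) (Grassmannian k n) \<phi>"
    by (simp_all add: birational_sequence_def d_def \<phi>_def \<pi>_def root_product_eq_root_prod)
  from bir obtain U V \<psi> where U: "openin (zariski (affine_space d)) U"
    and V: "openin (zariski (Grassmannian k n)) V" "V \<noteq> {}"
    and \<psi>VU: "morphism_on (Grassmannian k n) V (affine_space d) U \<psi>"
    and \<psi>\<phi>: "\<And>x. x \<in> U \<Longrightarrow> \<psi> (\<phi> x) = x" and \<phi>\<psi>: "\<And>y. y \<in> V \<Longrightarrow> \<phi> (\<psi> y) = y"
    unfolding birational_morphism_def by metis
  have Uc: "U \<subseteq> carrier_vec d" using U unfolding aff by (rule open_subset_affine)
  have \<psi>U: "\<psi> y \<in> U" if "y \<in> V" for y
    using \<psi>VU openin_subset[OF V(1)] that by (rule morphism_on_maps_to)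

  \<comment> \<open>a permutation of the row indices starting with the given rows, shifted to start at 0\<close>
  define L where "L = map (\<lambda>m. m - 1) i @ filter (\<lambda>a. a \<notin> set (map (\<lambda>m. m - 1) i)) [0..<n]"
  have "inj_on (\<lambda>m :: nat. m - 1) (set i)"
    using \<open>set i \<subseteq> {1..n}\<close> by (intro inj_on_diff_nat) auto
  then have L: "distinct L" "set L = {..<n}"
    using \<open>distinct i\<close> \<open>set i \<subseteq> {1..n}\<close> by (auto simp: L_def distinct_map subset_iff)
  have len: "length L = n" using distinct_card[OF L(1)] L(2) by simp
  have Ln: "L ! c < n" if "c < n" for c using that L(2) len nth_mem by fastforce
  have Li: "L ! l = i ! l - 1" if "l < k" for l
    using that \<open>length i = k\<close> by (simp add: L_def nth_append)

  let ?M = "completion n k L"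
  let ?h = "chart_lift n k L"
  let ?b = "bottom_functional n k L"
  define R where "R z = root_prod (Suc n) S' (\<lambda>l. z $ l)" for z :: "complex vec"
  define tail where "tail z = vec d (\<lambda>l. z $ (k + l))" for z :: "complex vec"
  define Om where "Om = {g \<in> SL (Suc n). det (?M g) \<noteq> 0 \<and> \<pi> (?h g) \<in> V}"
  \<comment> \<open>Defining \<open>V'\<close> as an image makes a matrix representing each of its points available.\<close>
  define V' where "V' = \<pi>' ` Om"
  define U' where "U' = {z \<in> carrier_vec D. tail z \<in> U \<and> R z \<in> Om}"
  \<comment> \<open>the inverse on matrices, descended to subspaces as \<open>\<Psi>\<close> by choosing a representative\<close>
  define sol where "sol g = vec D (\<lambda>l. if l < k then ?b g (L ! l) else \<psi> (\<pi> (?h g)) $ (l - k))" for g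
  define \<Psi> where "\<Psi> W = sol (SOME g. g \<in> Om \<and> \<pi>' g = W)" for W

  have "set S' \<subseteq> positive_roots (Suc n)"
    using S(1) \<open>set i \<subseteq> {1..n}\<close> by (fastforce simp: S'_def positive_roots_def)
  moreover have lenS': "length S' = D" using S(2) \<open>length i = k\<close> by (simp add: S'_def dD)
  ultimately have S': "set S' \<subseteq> positive_roots (Suc n)" "length S' = D" by auto
  have RSL: "R z \<in> SL (Suc n)" for z unfolding R_def by (rule root_prod_in_SL[OF S'(1)])
  have Rc: "R z \<in> carrier_mat (Suc n) (Suc n)" for z using RSL by (auto simp: SL_def)

  have Rtop: "R z $$ (r, c) = root_prod n S (\<lambda>l. tail z $ l) $$ (r, c)" if "r < n" "c < k" for z r c
  proof -
    have "root_prod n S (\<lambda>l. tail z $ l) = root_prod n S (\<lambda>l. z $ (k + l))"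
      by (rule root_prod_cong) (simp add: tail_def S)
    then show ?thesis
      using root_prod_extended(1)[OF S(1) \<open>set i \<subseteq> {1..n}\<close>, of c r "\<lambda>l. z $ l"] that k \<open>length i = k\<close>
      by (simp add: R_def S'_def)
  qed
  have Rbot: "R z $$ (n, c) = (\<Sum>l<k. z $ l * R z $$ (L ! l, c))" if "c < k" for z c
    using root_prod_extended(2)[OF S(1) \<open>set i \<subseteq> {1..n}\<close>, of c "\<lambda>l. z $ l"] that k \<open>length i = k\<close>
    by (simp add: R_def S'_def Li)
  have MR: "?M (R z) = ?M (root_prod n S (\<lambda>l. tail z $ l))" for z
    by (rule completion_cong) (rule Rtop)
  have \<pi>R: "\<pi> (?h (R z)) = \<phi> (tail z)" for z
    unfolding \<pi>_def \<phi>_def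
    using k by (intro first_cols_span_cong) (auto simp: index_chart_lift Rtop)
  have tailU: "tail (sol g) = \<psi> (\<pi> (?h g))" if "g \<in> Om" for g
  proof -
    have "\<psi> (\<pi> (?h g)) \<in> carrier_vec d" using that \<psi>U Uc by (auto simp: Om_def)
    then show ?thesis by (intro eq_vecI) (auto simp: tail_def sol_def dD)
  qed
  have Mh: "?M (?h g) = ?M g" for g
    by (rule completion_cong) (rule index_chart_lift[OF k])

  \<comment> \<open>The choice of the representative does not matter.\<close>
  have inv: "g' \<in> Om \<and> sol g' = sol g" if "g \<in> Om" "g' \<in> SL (Suc n)" "\<pi>' g' = \<pi>' g" for g g'
  proof -
    have "g \<in> carrier_mat (Suc n) (Suc n)" "g' \<in> carrier_mat (Suc n) (Suc n)" "det (?M g) \<noteq> 0"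
      using that by (auto simp: Om_def SL_def)
    note * = chart_span_invariant[OF this(1,2) k Ln _ this(3)]
    have "det (?M g') \<noteq> 0" "\<pi> (?h g') = \<pi> (?h g)" and b: "\<And>a. a < n \<Longrightarrow> ?b g' a = ?b g a"
      using * that(3) by (simp_all add: \<pi>_def \<pi>'_def)
    then show ?thesis
      using that Ln k by (auto simp: Om_def sol_def intro!: eq_vecI)
  qed
  have \<Psi>: "\<Psi> (\<pi>' g) = sol g" if "g \<in> Om" for g
  proof -
    let ?g = "SOME g'. g' \<in> Om \<and> \<pi>' g' = \<pi>' g"
    have "?g \<in> Om \<and> \<pi>' ?g = \<pi>' g" by (rule someI[of _ g]) (simp add: that)
    then show ?thesis using inv[OF that, of ?g] by (auto simp: \<Psi>_def Om_def)
  qed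
  have preimage: "{g \<in> SL (Suc n). \<pi>' g \<in> V'} = Om"
  proof (intro equalityI subsetI)
    fix g assume "g \<in> {g \<in> SL (Suc n). \<pi>' g \<in> V'}"
    then obtain g0 where "g0 \<in> Om" "g \<in> SL (Suc n)" "\<pi>' g = \<pi>' g0" unfolding V'_def by blast
    then show "g \<in> Om" using inv by blast
  next
    fix g assume "g \<in> Om"
    moreover from this have "g \<in> SL (Suc n)" by (simp add: Om_def)
    ultimately show "g \<in> {g \<in> SL (Suc n). \<pi>' g \<in> V'}" by (simp add: V'_def)
  qed

  have solU: "sol g \<in> U' \<and> \<pi>' (R (sol g)) = \<pi>' g" if g: "g \<in> Om" for g
  proof -
    let ?v = "\<psi> (\<pi> (?h g))"
    let ?A = "root_prod n S (\<lambda>l. ?v $ l)"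
    have g': "g \<in> carrier_mat (Suc n) (Suc n)" "det (?M g) \<noteq> 0" "\<pi> (?h g) \<in> V"
      using g by (auto simp: Om_def SL_def)
    have \<phi>v: "\<phi> ?v = \<pi> (?h g)" using \<phi>\<psi> g' by simp
    have "det (?M ?A) \<noteq> 0"
    proof (rule det_completion_span)
      show "first_cols_span k n (?h g) \<subseteq> first_cols_span k n ?A"
        using \<phi>v unfolding \<phi>_def \<pi>_def by (rule equalityD2)
    qed (use g' k in \<open>simp_all add: Mh\<close>)
    then have nz: "det (?M (R (sol g))) \<noteq> 0" by (simp add: MR tailU[OF g])
    have \<pi>h: "\<pi> (?h (R (sol g))) = \<pi> (?h g)" by (simp add: \<pi>R tailU[OF g] \<phi>v)
    have R: "R (sol g) \<in> Om" using RSL nz \<pi>h g' by (simp add: Om_def)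
    have b: "?b (R (sol g)) a = ?b g a" if "a < n" for a
    proof -
      have "a \<in> set L" using that L by simp
      then obtain l where l: "l < n" "a = L ! l" using len by (metis in_set_conv_nth)
      show ?thesis
      proof (cases "l < k")
        case True
        have "?b (R (sol g)) (L ! l) = sol g $ l"
          using k by (intro bottom_functional_eq_coefficients[OF nz _ L Rbot True]) auto
        then show ?thesis using True l by (simp add: sol_def dD)
      next
        case False
        then show ?thesis
          using l Ln[of l] bottom_functional_zero[OF nz, of l] bottom_functional_zero[OF g'(2), of l] by simp
      qed
    qed
    have "\<pi>' (R (sol g)) = \<pi>' g"
      unfolding \<pi>'_def using \<pi>h b
      by (intro subset_antisym chart_span_determined[OF Rc g'(1) k nz g'(2)]
          chart_span_determined[OF g'(1) Rc k g'(2) nz]) (auto simp: \<pi>_def)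
    then show ?thesis using R tailU[OF g] \<psi>U g' by (simp add: U'_def sol_def)
  qed
  have sol_R: "sol (R z) = z" if z: "z \<in> U'" for z
  proof (rule eq_vecI)
    have z': "dim_vec z = D" "det (?M (R z)) \<noteq> 0" "tail z \<in> U" using z by (auto simp: U'_def Om_def)
    then show "dim_vec (sol (R z)) = dim_vec z" by (simp add: sol_def)
    fix l assume "l < dim_vec z"
    then have l: "l < D" using z' by simp
    show "sol (R z) $ l = z $ l"
    proof (cases "l < k")
      case True
      have "?b (R z) (L ! l) = z $ l"
        using k by (intro bottom_functional_eq_coefficients[OF z'(2) _ L Rbot True]) auto
      then show ?thesis using l True by (simp add: sol_def)
    next
      case False
      have "\<psi> (\<pi> (?h (R z))) = tail z" using \<psi>\<phi> z' by (simp add: \<pi>R)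
      moreover have "k + (l - k) = l" "l - k < d" using l False dD by arith+
      ultimately show ?thesis using l False by (simp add: sol_def tail_def)
    qed
  qed

  let ?SLc = "{(\<lambda>g :: complex mat. g $$ (r, c)) | r c. r < Suc n \<and> c < Suc n}"
  have SL': "SL_variety (Suc n) = affine_variety (SL (Suc n)) ?SLc" by (simp add: SL_variety_def)
  define Om0 where "Om0 = {g \<in> SL (Suc n). det (?M g) \<noteq> 0}"
  have SLtop: "openin (zariski (SL_variety (Suc n))) (SL (Suc n))"
    using openin_topspace[of "zariski (SL_variety (Suc n))"] by (simp add: topspace_SL)
  have "regular (SL_variety (Suc n)) (SL (Suc n)) (\<lambda>g. det (?M g))"
    using regular_SL_entry[OF SLtop] SLtop k unfolding SL' by (intro regular_det_completion) auto
  then have Om0: "openin (zariski (SL_variety (Suc n))) Om0"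
    unfolding SL' Om0_def by (rule openin_regular_nonzero)
  have hreg: "regular (SL_variety (Suc n)) Om0 (\<lambda>g. c (?h g))"
    if "c \<in> {(\<lambda>g. g $$ (r, c)) | r c. r < n \<and> c < n}" for c
  proof -
    obtain r s where "c = (\<lambda>g. g $$ (r, s))" "r < n" "s < n" using \<open>c \<in> _\<close> by blast
    then show ?thesis
      using regular_SL_entry[OF Om0] Om0 k unfolding SL'
      by (auto intro!: regular_chart_lift simp: Om0_def)
  qed
  have hSL: "?h g \<in> SL n" if "g \<in> Om0" for g using that k by (intro chart_lift_in_SL) (auto simp: Om0_def)
  have Vpre: "openin (zariski (SL_variety n)) {g \<in> SL n. \<pi> g \<in> V}"
    using V(1) by (simp add: openin_Grassmannian_iff \<pi>_def)
  have OmOm0: "Om = {g \<in> Om0. ?h g \<in> {g \<in> SL n. \<pi> g \<in> V}}"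
    using hSL by (auto simp: Om_def Om0_def)
  have Om: "openin (zariski (SL_variety (Suc n))) Om"
    unfolding OmOm0 using openin_regular_preimage[where F = ?h, OF Om0[unfolded SL'] hSL hreg[unfolded SL']
        Vpre[unfolded SL_variety_def]] by (simp only: SL')
  have V'sub: "V' \<subseteq> subspaces_of_dim k (Suc n)"
    using first_cols_span_subspace[of _ "Suc n" k] k by (auto simp: V'_def Om_def \<pi>'_def)
  have V': "openin (zariski (Grassmannian k (Suc n))) V'"
    using V'sub Om preimage by (simp add: openin_Grassmannian_iff \<pi>'_def)

  have AD: "openin (zariski (affine_space D)) (carrier_vec D)"
    unfolding aff by (rule openin_affine_topspace)
  have coordreg: "regular (affine_space m) N (\<lambda>v. v $ l)"
    if "openin (zariski (affine_space m)) N" "l < m" for N l m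
    using that unfolding aff by (intro regular_coord) (auto simp: coords_def)
  have Rreg: "regular (affine_space D) N (\<lambda>z. R z $$ (r, c))"
    if "openin (zariski (affine_space D)) N" "r < Suc n" "c < Suc n" for N r c
    using that coordreg[OF that(1)] S' unfolding R_def aff by (intro regular_root_prod) auto
  have 1: "openin (zariski (affine_space D)) {z \<in> carrier_vec D. tail z \<in> U}"
    unfolding aff
  proof (rule openin_regular_preimage[where F = tail])
    fix c assume "c \<in> coords d"
    then obtain l where "l < d" "c = (\<lambda>v. v $ l)" by (auto simp: coords_def)
    then show "regular (affine_variety (carrier_vec D) (coords D)) (carrier_vec D) (\<lambda>x. c (tail x))"
      using coordreg[OF AD, of "k + l"] by (simp add: tail_def aff dD)
  qed (use AD U in \<open>auto simp: aff tail_def\<close>)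
  have 2: "openin (zariski (affine_space D)) {z \<in> carrier_vec D. R z \<in> Om}"
    unfolding aff
  proof (rule openin_regular_preimage[where F = R, OF AD[unfolded aff] RSL _ Om[unfolded SL']])
    fix c :: "complex mat \<Rightarrow> complex" assume "c \<in> ?SLc"
    then show "regular (affine_variety (carrier_vec D) (coords D)) (carrier_vec D) (\<lambda>x. c (R x))"
      using Rreg[OF AD] by (auto simp: aff)
  qed
  have U': "openin (zariski (affine_space D)) U'"
    using openin_Int[OF 1 2] by (simp add: U'_def Int_def conj_comms conj_left_commute)

  have R_morphism: "morphism_on (affine_space D) N (Grassmannian k (Suc n)) W (\<lambda>z. \<pi>' (R z))"
    if "openin (zariski (affine_space D)) N" "\<And>z. z \<in> N \<Longrightarrow> \<pi>' (R z) \<in> W" "W \<subseteq> subspaces_of_dim k (Suc n)"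
    for N W
    using that Rreg[OF that(1)] RSL k unfolding aff \<pi>'_def by (intro morphism_to_Grassmannian) auto

  have \<psi>reg: "regular (SL_variety n) {g \<in> SL n. \<pi> g \<in> V} (\<lambda>g. \<psi> (\<pi> g) $ l)" if "l < d" for l
  proof -
    have "regular (Grassmannian k n) {y \<in> V. \<psi> y \<in> U} ((\<lambda>v. v $ l) \<circ> \<psi>)"
      using \<psi>VU U coordreg[OF U that] by (auto simp: morphism_on_def)
    moreover have "{y \<in> V. \<psi> y \<in> U} = V" using \<psi>U by auto
    ultimately show ?thesis by (simp add: regular_Grassmannian_iff \<pi>_def)
  qed
  have \<Psi>_morphism: "morphism_on (Grassmannian k (Suc n)) V' (affine_space D) U' \<Psi>"
    unfolding aff
  proof (rule morphism_from_Grassmannian[OF V'])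
    show "k \<le> Suc n" using k by simp
    show "\<Psi> W \<in> U'" if "W \<in> V'" for W using that \<Psi> solU by (auto simp: V'_def)
    show "U' \<subseteq> carrier_vec D" by (auto simp: U'_def)
    fix c assume "c \<in> coords D"
    then obtain l where l: "l < D" "c = (\<lambda>v. v $ l)" by (auto simp: coords_def)
    have "regular (SL_variety (Suc n)) Om (\<lambda>g. sol g $ l)"
    proof (cases "l < k")
      case True
      have "regular (SL_variety (Suc n)) Om (\<lambda>g. ?b g (L ! l))"
        using True k Ln[of l] regular_SL_entry[OF Om] Om unfolding SL'
        by (intro regular_bottom_functional) (auto simp: Om_def)
      then show ?thesis using True l by (simp add: sol_def)
    next
      case False
      have "regular (SL_variety (Suc n)) Om (\<lambda>g. \<psi> (\<pi> (?h g)) $ (l - k))"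
        using regular_pullback[where F = ?h and f = "\<lambda>g. \<psi> (\<pi> g) $ (l - k)",
            OF Om0[unfolded SL'] hSL hreg[unfolded SL'] \<psi>reg[unfolded SL_variety_def]] False l
        unfolding OmOm0 by (simp add: SL' dD)
      then show ?thesis using False l by (simp add: sol_def)
    qed
    then have "regular (SL_variety (Suc n)) Om (\<lambda>g. c (\<Psi> (\<pi>' g)))"
      unfolding SL' by (rule regular_cong) (simp add: \<Psi> l)
    then show "regular (SL_variety (Suc n)) {g \<in> SL (Suc n). first_cols_span k (Suc n) g \<in> V'}
        (\<lambda>g. c (\<Psi> (first_cols_span k (Suc n) g)))"
      using preimage by (simp add: \<pi>'_def)
  qed

  \<comment> \<open>By density some point of \<open>V\<close> lies in the chart; any parameters of the new roots do above it.\<close>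
  have "\<exists>z. z \<in> U'"
  proof -
    obtain y where y: "y \<in> V" using V(2) by blast
    have "root_prod n S (\<lambda>l. \<psi> y $ l) \<in> {g \<in> SL n. \<pi> g \<in> V}"
      using root_prod_in_SL[OF S(1)] \<phi>\<psi>[OF y] y by (simp add: \<phi>_def)
    then obtain g where g: "g \<in> SL n" "\<pi> g \<in> V" "det (?M g) \<noteq> 0"
      using chart_dense[OF Vpre _ k L] by blast
    define v where "v = \<psi> (\<pi> g)"
    have v: "v \<in> U" "\<phi> v = \<pi> g" using \<psi>U \<phi>\<psi> g by (auto simp: v_def)
    define z where "z = vec D (\<lambda>l. if l < k then 0 else v $ (l - k))"
    have z: "tail z = v"
      using v Uc by (intro eq_vecI) (auto simp: tail_def z_def dD)
    have "det (?M (root_prod n S (\<lambda>l. v $ l))) \<noteq> 0"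
    proof (rule det_completion_span)
      show "first_cols_span k n g \<subseteq> first_cols_span k n (root_prod n S (\<lambda>l. v $ l))"
        using v(2) unfolding \<phi>_def \<pi>_def by (rule equalityD2)
    qed (use g k in \<open>simp_all add: SL_def\<close>)
    then have "R z \<in> Om" using RSL \<pi>R[of z] MR[of z] z v g by (simp add: Om_def)
    then show ?thesis using z v by (intro exI[of _ z]) (auto simp: U'_def z_def)
  qed
  then have ne: "U' \<noteq> {}" "V' \<noteq> {}" by (auto simp: U'_def V'_def)
  have "birational_morphism (affine_space D) (Grassmannian k (Suc n)) (\<lambda>z. \<pi>' (R z))"
    unfolding birational_morphism_def
  proof (intro conjI exI)
    have "topspace (zariski (affine_space D)) = carrier_vec D" by (simp add: aff topspace_affine)
    moreover have "topspace (zariski (Grassmannian k (Suc n))) = subspaces_of_dim k (Suc n)"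
      using k by (simp add: topspace_Grassmannian)
    ultimately show "morphism_on (affine_space D) (topspace (zariski (affine_space D)))
        (Grassmannian k (Suc n)) (topspace (zariski (Grassmannian k (Suc n)))) (\<lambda>z. \<pi>' (R z))"
      using R_morphism[OF AD, of "subspaces_of_dim k (Suc n)"] first_cols_span_subspace[OF RSL, of k] k
      by (simp add: \<pi>'_def)
    show "morphism_on (affine_space D) U' (Grassmannian k (Suc n)) V' (\<lambda>z. \<pi>' (R z))"
      using U' V'sub by (intro R_morphism) (auto simp: U'_def V'_def)
    show "morphism_on (Grassmannian k (Suc n)) V' (affine_space D) U' \<Psi>" by (rule \<Psi>_morphism)
    show "\<forall>z\<in>U'. \<Psi> (\<pi>' (R z)) = z" using \<Psi> sol_R by (auto simp: U'_def)
    show "\<forall>W\<in>V'. \<pi>' (R (\<Psi> W)) = W" using \<Psi> solU by (auto simp: V'_def)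
  qed (use U' V' ne in auto)
  then have "birational_sequence k (Suc n) S'"
    using S' by (simp add: birational_sequence_def D_def R_def \<pi>'_def root_product_eq_root_prod)
  then show ?thesis by (simp add: S'_def)
qed

end
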